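(* Under the BilateralMatch(E) policy $\mathcal{B}_E$ and in steady-state, the average waiting time $w_H^{\mathcal{B}_E}$ of $H$ agents satisfies the following. (i) If $\lambda_H<\lambda_E$, then $$\frac{\ln\left(\frac{\lambda_E}{\lambda_E-\lambda_H}\right)}{p_E\lambda_H}\le \lim_{p_H\to0}p_H\,w_H^{\mathcal{B}_E}\le\frac{\ln\left(\frac{2\lambda_E}{\lambda_E-\lambda_H}\right)}{p_E\lambda_H}.$$ (ii) If $\lambda_H>\lambda_E$, then $\displaystyle\lim_{p_H\to0}p_H^2\,w_H^{\mathcal{B}_E}=\frac{\ln\left(\frac{2\lambda_H}{\lambda_H+\lambda_E}\right)}{\lambda_H}$.
   Context: Model: agents of two types $H$ (hard-to-match) and $E$ (easy-to-match) arrive to a market according to independent Poisson processes with rates $\lambda_H,\lambda_E>0$. Each agent owns an item; an agent of type $T\in\{H,E\}$ finds the item of any other agent compatible with probability $p_T$, independently over all ordered pairs. Here $p_E\in(0,1]$ is a fixed constant and $p_H\in(0,1)$ is a parameter tending to $0$. Two agents can form a bilateral exchange (2-cycle) if each finds the other's item compatible. Policy BilateralMatch(E) ($\mathcal{B}_E$): upon arrival of a new agent, if a 2-cycle can be formed between it and a waiting agent, one such cycle is executed and both agents leave; if there are several such cycles, priority is given to cycles whose waiting agent is of type $E$, further ties being broken uniformly at random. Otherwise the new agent joins the market and waits. The numbers $[H_t,E_t]\in\mathbb{N}^2$ of waiting $H$ and $E$ agents form a positive recurrent continuous-time Markov chain with transition rates (convention $0^0=1$) $Q([h,e],[h+1,e])=\lambda_H(1-p_H^2)^h(1-p_Ep_H)^e$,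 $Q([h,e],[h-1,e])=\lambda_H(1-p_Ep_H)^e(1-(1-p_H^2)^h)+\lambda_E(1-p_E^2)^e(1-(1-p_Ep_H)^h)$, $Q([h,e],[h,e+1])=\lambda_E(1-p_Ep_H)^h(1-p_E^2)^e$, $Q([h,e],[h,e-1])=\lambda_H(1-(1-p_Ep_H)^e)+\lambda_E(1-(1-p_E^2)^e)$. $[H^{\mathcal{B}_E},E^{\mathcal{B}_E}]$ denotes a random vector with the stationary distribution. The steady-state average waiting time of $H$ agents is, by Little's law, $w_H^{\mathcal{B}_E}=\mathbb{E}[H^{\mathcal{B}_E}]/\lambda_H$. *)

theory Defs
  imports "HOL-Probability.Probability"
begin

text \<open>
  Continuous-time Markov chains on a countable state space are given by their transition rates
  \<open>Q s t\<close> for \<open>s \<noteq> t\<close>; the values \<open>Q s s\<close> are never used.  A stationary distribution is a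
  probability distribution solving the balance equations (flow into every state = flow out of it).
  The infinite sum over \<open>t\<close> in the outflow is meaningful for chains with summable rates out of
  every state, in particular when only finitely many rates out of each state are nonzero.
\<close>

definition stationary_distribution :: "('s \<Rightarrow> 's \<Rightarrow> real) \<Rightarrow> 's pmf \<Rightarrow> bool" where
  "stationary_distribution Q \<pi> \<longleftrightarrow>
     (\<forall>s. ((\<lambda>t. pmf \<pi> t * Q t s) has_sum (pmf \<pi> s * (\<Sum>\<^sub>\<infinity>t\<in>-{s}. Q s t))) (-{s}))"

text \<open>
  Transition rates of the chain of the numbers \<open>(h, e)\<close> of waiting hard- and easy-to-match agents
  under the policy that executes one 2-cycle between an arriving agent and a waiting agent whenever
  one exists, giving priority to waiting agents of type E.  An arriving agent of type S and a
  waiting agent of type T form a 2-cycle with probability \<open>pS * pT\<close>.  Downward transitions are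
  selected by \<open>h = h' + 1\<close> and \<open>e = e' + 1\<close>, because subtraction on \<^typ>\<open>nat\<close> truncates.  The
  convention \<open>0 ^ 0 = 1\<close>, relevant for \<open>pE = 1\<close>, is built into the power operation.
\<close>

definition bilateral_match_E_rate ::
  "real \<Rightarrow> real \<Rightarrow> real \<Rightarrow> real \<Rightarrow> nat \<times> nat \<Rightarrow> nat \<times> nat \<Rightarrow> real" where
  "bilateral_match_E_rate lamH lamE pE pH = (\<lambda>(h, e) (h', e').
     if h' = h + 1 \<and> e' = e then
       lamH * (1 - pH\<^sup>2) ^ h * (1 - pE * pH) ^ e
     else if h = h' + 1 \<and> e' = e then
       lamH * (1 - pE * pH) ^ e * (1 - (1 - pH\<^sup>2) ^ h)
         + lamE * (1 - pE\<^sup>2) ^ e * (1 - (1 - pE * pH) ^ h)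
     else if h' = h \<and> e' = e + 1 then
       lamE * (1 - pE * pH) ^ h * (1 - pE\<^sup>2) ^ e
     else if h' = h \<and> e = e' + 1 then
       lamH * (1 - (1 - pE * pH) ^ e) + lamE * (1 - (1 - pE\<^sup>2) ^ e)
     else 0)"

text \<open>
  Average waiting time of hard-to-match agents, given by Little's law as the mean number of waiting
  H agents divided by their arrival rate.  It is taken in \<^typ>\<open>ennreal\<close> so that an infinite
  mean counts as infinite; the Bochner integral would silently turn it into \<open>0\<close>.
\<close>

definition avg_waiting_time_H :: "real \<Rightarrow> (nat \<times> nat) pmf \<Rightarrow> ennreal" where
  "avg_waiting_time_H lamH \<pi> =
     (\<integral>\<^sup>+ (h, e). ennreal (real h) \<partial>measure_pmf \<pi>) / ennreal lamH"

end

theory Submission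
  imports Defs
begin

text \<open>
  Write \<open>y = (1 - pE * pH) ^ h\<close> and \<open>v = (1 - pH\<^sup>2) ^ h\<close>.  The E-component is fast: for fixed \<open>h\<close> it
  equilibrates, and equating its up and down flows shows that the mean of \<open>(1 - pE\<^sup>2) ^ e\<close> becomes
  \<open>1 / (1 + y)\<close>.  The averaged downward drift of \<open>h\<close> is therefore
  \<open>lamH * (1 - 2 * v) + lamE * (1 - y) / (1 + y)\<close>.  It vanishes at \<open>h = x / pH\<close> with
  \<open>exp (- pE * x) = (lamE - lamH) / (lamE + lamH)\<close> if \<open>lamH < lamE\<close> (where \<open>v\<close> tends to \<open>1\<close>), and at
  \<open>h = x / pH\<^sup>2\<close> with \<open>exp (- x) = (lamH + lamE) / (2 * lamH)\<close> if \<open>lamH > lamE\<close> (where \<open>y\<close> tends to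
  \<open>0\<close>).  Let \<open>\<theta>\<close> be the scale (\<open>pH\<close> or \<open>pH\<^sup>2\<close>) and \<open>m < x < M\<close>.  Testing stationarity against functions
  whose \<open>h\<close>-increments are \<open>max 0 (\<theta> * h - M)\<close> or \<open>max 0 (m - \<theta> * h)\<close>, which are supported where the
  drift has a strict sign, shows that the means of these two increments are \<open>O(pH)\<close>.  Hence the
  mean of \<open>\<theta> * h\<close> tends to \<open>x\<close>, which also gives the limit in case (i) explicitly.
\<close>

subsection \<open>Stationary expectations\<close>

lemma abs_summable_on_real_iff:
  fixes f :: "'a \<Rightarrow> real"
  shows "(\<lambda>x. \<bar>f x\<bar>) summable_on A \<longleftrightarrow> f summable_on A"
  using summable_on_iff_abs_summable_on_real[of f A] by simp

text \<open>The balance equations are written with unordered sums, expectations as Bochner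
  integrals. The two notions meet because \<open>\<pi>\<close> has density \<open>pmf \<pi>\<close>
  with respect to counting measure and unordered summability of reals is absolute.\<close>

lemma integrable_measure_pmf_iff_summable_on:
  fixes f :: "'s \<Rightarrow> real"
  shows "integrable (measure_pmf \<pi>) f \<longleftrightarrow> (\<lambda>x. pmf \<pi> x * f x) summable_on UNIV"
proof -
  have "integrable (measure_pmf \<pi>) f \<longleftrightarrow>
      Infinite_Set_Sum.abs_summable_on (\<lambda>x. pmf \<pi> x * f x) UNIV"
    unfolding measure_pmf_eq_density abs_summable_on_def
    by (subst integrable_density) auto
  then show ?thesis
    by (simp only: abs_summable_equivalent[symmetric] real_norm_def abs_summable_on_real_iff)
qed

lemma integrable_measure_pmf_bounded:
  fixes f :: "'s \<Rightarrow> real"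
  assumes "\<And>s. \<bar>f s\<bar> \<le> B"
  shows "integrable (measure_pmf \<pi>) f"
  by (rule measure_pmf.integrable_const_bound[where B = B]) (simp_all add: assms)

lemma expectation_measure_pmf_eq_infsum:
  fixes f :: "'s \<Rightarrow> real"
  assumes "integrable (measure_pmf \<pi>) f"
  shows "measure_pmf.expectation \<pi> f = (\<Sum>\<^sub>\<infinity>x. pmf \<pi> x * f x)"
proof -
  have s: "Infinite_Set_Sum.abs_summable_on (\<lambda>x. pmf \<pi> x * f x) UNIV"
    using assms unfolding measure_pmf_eq_density abs_summable_on_def
    by (subst (asm) integrable_density) auto
  have "measure_pmf.expectation \<pi> f = infsetsum (\<lambda>x. pmf \<pi> x * f x) UNIV"
    unfolding measure_pmf_eq_density infsetsum_def
    by (subst integral_density) auto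
  with s show ?thesis
    by (simp add: infsetsum_infsum)
qed

text \<open>
  Multiplying the balance equation at \<open>t\<close> by \<open>g t\<close> and summing over \<open>t\<close>: bounded rates make the
  double sum absolutely convergent, so that it can be interchanged.
\<close>

lemma stationary_distribution_expectation_generator:
  fixes Q :: "'s \<Rightarrow> 's \<Rightarrow> real" and N :: "'s \<Rightarrow> 's set"
  assumes stat: "stationary_distribution Q \<pi>"
    and nonneg: "\<And>s t. 0 \<le> Q s t" and diag: "\<And>s. Q s s = 0"
    and fin: "\<And>s. finite (N s)" and supp: "\<And>s t. t \<notin> N s \<Longrightarrow> Q s t = 0"
    and bound: "\<And>s. (\<Sum>t\<in>N s. Q s t) \<le> C"
    and g: "integrable (measure_pmf \<pi>) g"
  shows "measure_pmf.expectation \<pi> (\<lambda>s. \<Sum>t\<in>N s. Q s t * (g t - g s)) = 0"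
proof -
  define q where "q s = (\<Sum>t\<in>N s. Q s t)" for s
  define F where "F = (\<lambda>(t, s). pmf \<pi> s * Q s t * g t)"
  have q0: "0 \<le> q s" "q s \<le> C" for s
    using nonneg bound by (auto simp: q_def intro: sum_nonneg)
  have out: "(\<Sum>\<^sub>\<infinity>t\<in>-{s}. Q s t) = q s" for s
  proof -
    have "(\<Sum>\<^sub>\<infinity>t\<in>-{s}. Q s t) = (\<Sum>\<^sub>\<infinity>t\<in>N s. Q s t)"
      by (rule infsum_cong_neutral) (auto simp: diag supp)
    then show ?thesis by (simp add: q_def fin)
  qed
  have bal: "((\<lambda>s. pmf \<pi> s * Q s t) has_sum (pmf \<pi> t * q t)) UNIV" for t
  proof -
    have "((\<lambda>s. pmf \<pi> s * Q s t) has_sum (pmf \<pi> t * q t)) (-{t})"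
      using stat[unfolded stationary_distribution_def, rule_format, of t] by (simp only: out)
    moreover have "((\<lambda>s. pmf \<pi> s * Q s t) has_sum (pmf \<pi> t * q t)) (-{t}) \<longleftrightarrow>
        ((\<lambda>s. pmf \<pi> s * Q s t) has_sum (pmf \<pi> t * q t)) UNIV"
      by (rule has_sum_cong_neutral) (auto simp: diag)
    ultimately show ?thesis by blast
  qed
  have sg: "(\<lambda>t. pmf \<pi> t * g t) summable_on UNIV"
    by (rule integrable_measure_pmf_iff_summable_on[THEN iffD1, OF g])
  \<comment> \<open>The total flow through \<open>t\<close>, weighted by
    \<open>\<bar>g t\<bar>\<close>, is dominated by \<open>C\<close> times the integrable
    \<open>\<bar>g\<bar>\<close>; here the bounded rates enter.\<close>
  have sgq: "(\<lambda>t. pmf \<pi> t * q t * \<bar>g t\<bar>) summable_on UNIV"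
  proof (rule summable_on_comparison_test)
    show "(\<lambda>t. \<bar>pmf \<pi> t * g t\<bar> * C) summable_on UNIV"
      by (intro summable_on_cmult_left) (simp only: abs_summable_on_real_iff sg)
    show "pmf \<pi> t * q t * \<bar>g t\<bar> \<le> \<bar>pmf \<pi> t * g t\<bar> * C" for t
      using mult_left_mono[OF q0(2)[of t], of "pmf \<pi> t * \<bar>g t\<bar>"] by (simp add: abs_mult mult_ac)
  qed (simp add: q0)
  \<comment> \<open>Summing over the source \<open>s\<close> first turns the inner sum into inflow
    at \<open>t\<close>, which the balance equation evaluates as
    \<open>pmf \<pi> t * q t\<close>.\<close>
  have "(\<lambda>x. \<bar>F x\<bar>) summable_on UNIV \<times> UNIV"
  proof (rule summable_on_SigmaI)
    show "((\<lambda>s. \<bar>F (t, s)\<bar>) has_sum (pmf \<pi> t * q t * \<bar>g t\<bar>)) UNIV" for t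
      using has_sum_cmult_left[OF bal[of t], of "\<bar>g t\<bar>"]
      by (simp add: F_def abs_mult nonneg)
  qed (use sgq in auto)
  then have F: "(\<lambda>(t, s). pmf \<pi> s * Q s t * g t) summable_on UNIV \<times> UNIV"
    by (simp only: F_def abs_summable_on_real_iff)
  have inner: "(\<Sum>\<^sub>\<infinity>t. pmf \<pi> s * Q s t * g t) = pmf \<pi> s * (\<Sum>t\<in>N s. Q s t * g t)" for s
  proof -
    have "(\<Sum>\<^sub>\<infinity>t. pmf \<pi> s * Q s t * g t) = (\<Sum>\<^sub>\<infinity>t\<in>N s. pmf \<pi> s * Q s t * g t)"
      by (rule infsum_cong_neutral) (auto simp: supp)
    then show ?thesis by (simp add: fin sum_distrib_left mult.assoc)
  qed
  have "(\<Sum>\<^sub>\<infinity>t. \<Sum>\<^sub>\<infinity>s. pmf \<pi> s * Q s t * g t) = (\<Sum>\<^sub>\<infinity>s. \<Sum>\<^sub>\<infinity>t. pmf \<pi> s * Q s t * g t)"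
    by (rule infsum_swap_banach[OF F])
  moreover have "(\<Sum>\<^sub>\<infinity>s. pmf \<pi> s * Q s t * g t) = pmf \<pi> t * (q t * g t)" for t
    using has_sum_cmult_left[OF bal[of t], of "g t"] by (simp add: infsumI mult.assoc)
  ultimately have eq: "(\<Sum>\<^sub>\<infinity>t. pmf \<pi> t * (q t * g t)) =
      (\<Sum>\<^sub>\<infinity>s. pmf \<pi> s * (\<Sum>t\<in>N s. Q s t * g t))"
    by (simp add: inner)
  have "(\<lambda>(s, t). pmf \<pi> s * Q s t * g t) summable_on UNIV \<times> UNIV"
    using F summable_on_swap[of "\<lambda>(s, t). pmf \<pi> s * Q s t * g t" UNIV UNIV]
    by (simp add: case_prod_unfold)
  from summable_on_Sigma_banach[OF this]
  have s1: "(\<lambda>s. pmf \<pi> s * (\<Sum>t\<in>N s. Q s t * g t)) summable_on UNIV"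
    by (simp add: inner)
  have s2: "(\<lambda>t. pmf \<pi> t * (q t * g t)) summable_on UNIV"
    using sgq unfolding abs_summable_on_real_iff[of "\<lambda>t. pmf \<pi> t * (q t * g t)", symmetric]
    by (simp add: abs_mult q0 mult.assoc)
  have i1: "integrable (measure_pmf \<pi>) (\<lambda>s. \<Sum>t\<in>N s. Q s t * g t)"
    and i2: "integrable (measure_pmf \<pi>) (\<lambda>s. q s * g s)"
    using s1 s2 by (simp_all add: integrable_measure_pmf_iff_summable_on)
  have "(\<Sum>t\<in>N s. Q s t * (g t - g s)) = (\<Sum>t\<in>N s. Q s t * g t) - q s * g s" for s
    unfolding q_def right_diff_distrib sum_subtractf sum_distrib_right ..
  then have "measure_pmf.expectation \<pi> (\<lambda>s. \<Sum>t\<in>N s. Q s t * (g t - g s)) =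
      measure_pmf.expectation \<pi> (\<lambda>s. (\<Sum>t\<in>N s. Q s t * g t) - q s * g s)"
    by presburger
  also have "\<dots> = measure_pmf.expectation \<pi> (\<lambda>s. \<Sum>t\<in>N s. Q s t * g t) -
      measure_pmf.expectation \<pi> (\<lambda>s. q s * g s)"
    by (rule Bochner_Integration.integral_diff[OF i1 i2])
  also have "\<dots> = 0"
    unfolding expectation_measure_pmf_eq_infsum[OF i1] expectation_measure_pmf_eq_infsum[OF i2] eq
    by (rule diff_self)
  finally show ?thesis .
qed

text \<open>
  Summation by parts of the stationarity identity for the test function
  \<open>\<Sum>k<min (f s) m. c k\<close>, which stays bounded; then \<open>m \<rightarrow> \<infinity>\<close>.
\<close>

lemma expectation_cut_equation:
  fixes f :: "'s \<Rightarrow> nat" and U D :: "'s \<Rightarrow> real" and c :: "nat \<Rightarrow> real"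
  assumes gen: "\<And>G :: nat \<Rightarrow> real. (\<exists>B. \<forall>k. \<bar>G k\<bar> \<le> B) \<Longrightarrow>
      measure_pmf.expectation \<pi>
        (\<lambda>s. U s * (G (f s + 1) - G (f s)) + D s * (G (f s - 1) - G (f s))) = 0"
    and U: "\<And>s. \<bar>U s\<bar> \<le> C" and D: "\<And>s. \<bar>D s\<bar> \<le> C" and D0: "\<And>s. f s = 0 \<Longrightarrow> D s = 0"
    and c: "\<And>k. \<bar>c k\<bar> \<le> B"
  shows "measure_pmf.expectation \<pi> (\<lambda>s. c (f s) * U s) =
    measure_pmf.expectation \<pi> (\<lambda>s. c (f s - 1) * D s)"
proof -
  have C: "0 \<le> C" using order_trans[OF abs_ge_zero U] .
  have B: "0 \<le> B" using order_trans[OF abs_ge_zero c] .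
  have cU: "\<bar>c (f s) * U s\<bar> \<le> B * C" and cD: "\<bar>c (f s - 1) * D s\<bar> \<le> B * C" for s
    using c U D B C by (auto simp: abs_mult intro!: mult_mono)
  define F where "F m s = (if f s < m then c (f s) * U s else 0) -
    (if f s - 1 < m then c (f s - 1) * D s else 0)" for m s
  have F0: "measure_pmf.expectation \<pi> (F m) = 0" for m
  proof -
    define G where "G k = (\<Sum>j<min k m. c j)" for k
    have "\<bar>G k\<bar> \<le> real m * B" for k
    proof -
      have "\<bar>G k\<bar> \<le> (\<Sum>j<min k m. \<bar>c j\<bar>)" unfolding G_def by (rule sum_abs)
      also have "\<dots> \<le> (\<Sum>j<m. B)"
        using c B by (intro order.trans[OF sum_mono2[of "{..<m}" "{..<min k m}"] sum_mono]) auto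
      finally show ?thesis by simp
    qed
    then have "\<exists>B. \<forall>k. \<bar>G k\<bar> \<le> B" by blast
    moreover have "U s * (G (f s + 1) - G (f s)) + D s * (G (f s - 1) - G (f s)) = F m s" for s
    proof -
      have up: "G (k + 1) - G k = (if k < m then c k else 0)" for k
        by (cases "k < m") (auto simp: G_def min_def)
      show ?thesis
      \<comment> \<open>At \<open>f s = 0\<close> truncated subtraction would leave a spurious
        \<open>c 0 * D s\<close> in \<open>F\<close>; \<open>D0\<close> removes it.\<close>
      proof (cases "f s")
        case 0
        then show ?thesis using up[of 0] by (simp add: F_def D0)
      next
        case (Suc k)
        then show ?thesis using up[of k] up[of "Suc k"] by (simp add: F_def algebra_simps)
      qed
    qed
    ultimately show ?thesis using gen[of G] by simp
  qed
  have "(\<lambda>m. measure_pmf.expectation \<pi> (F m)) \<longlonglongrightarrow>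
    measure_pmf.expectation \<pi> (\<lambda>s. c (f s) * U s - c (f s - 1) * D s)"
  proof (rule integral_dominated_convergence[where w = "\<lambda>_. B * C + B * C"])
    show "AE s in measure_pmf \<pi>. (\<lambda>m. F m s) \<longlonglongrightarrow> c (f s) * U s - c (f s - 1) * D s"
    proof (rule AE_I2)
      fix s
      have "\<forall>\<^sub>F m in sequentially. F m s = c (f s) * U s - c (f s - 1) * D s"
        using eventually_gt_at_top[of "f s"] by eventually_elim (auto simp: F_def)
      then show "(\<lambda>m. F m s) \<longlonglongrightarrow> c (f s) * U s - c (f s - 1) * D s"
        by (rule tendsto_eventually)
    qed
    show "AE s in measure_pmf \<pi>. norm (F m s) \<le> B * C + B * C" for m
    proof (rule AE_I2)
      fix s
      show "norm (F m s) \<le> B * C + B * C"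
        using cU[of s] cD[of s] mult_nonneg_nonneg[OF B C] unfolding F_def real_norm_def
        by (smt (verit))
    qed
  qed auto
  then have "measure_pmf.expectation \<pi> (\<lambda>s. c (f s) * U s - c (f s - 1) * D s) = 0"
    unfolding F0 by (rule LIMSEQ_unique[OF _ tendsto_const])
  moreover have i1: "integrable (measure_pmf \<pi>) (\<lambda>s. c (f s) * U s)"
    and i2: "integrable (measure_pmf \<pi>) (\<lambda>s. c (f s - 1) * D s)"
    using integrable_measure_pmf_bounded[OF cU] integrable_measure_pmf_bounded[OF cD] .
  ultimately show ?thesis
    using Bochner_Integration.integral_diff[OF i1 i2] by linarith
qed

text \<open>Monotone convergence. Cut equations need bounded weights, so an unbounded function is
  first truncated at \<open>n\<close> and estimated uniformly in \<open>n\<close>.\<close>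

lemma nn_integral_le_of_min:
  fixes f :: "'s \<Rightarrow> real"
  assumes nonneg: "\<And>s. 0 \<le> f s"
    and bound: "\<And>n::nat. measure_pmf.expectation \<pi> (\<lambda>s. min (f s) (real n)) \<le> K"
  shows "(\<integral>\<^sup>+ s. ennreal (f s) \<partial>measure_pmf \<pi>) \<le> ennreal K"
proof (rule LIMSEQ_le_const2)
  show "(\<lambda>n. \<integral>\<^sup>+ s. ennreal (min (f s) (real n)) \<partial>measure_pmf \<pi>)
      \<longlonglongrightarrow> (\<integral>\<^sup>+ s. ennreal (f s) \<partial>measure_pmf \<pi>)"
  proof (rule nn_integral_LIMSEQ)
    show "incseq (\<lambda>n s. ennreal (min (f s) (real n)))"
      by (auto simp: incseq_def le_fun_def intro!: ennreal_leI)
    fix s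
    have "\<forall>\<^sub>F n in sequentially. ennreal (min (f s) (real n)) = ennreal (f s)"
      using eventually_ge_at_top[of "nat \<lceil>f s\<rceil>"]
      by eventually_elim (simp add: min_absorb1 nat_ceiling_le_eq)
    then show "(\<lambda>n. ennreal (min (f s) (real n))) \<longlonglongrightarrow> ennreal (f s)"
      by (rule tendsto_eventually)
  qed auto
  have "(\<integral>\<^sup>+ s. ennreal (min (f s) (real n)) \<partial>measure_pmf \<pi>) \<le> ennreal K" for n
  proof -
    have "integrable (measure_pmf \<pi>) (\<lambda>s. min (f s) (real n))"
      using nonneg by (intro integrable_measure_pmf_bounded[where B = "real n"]) (simp add: abs_of_nonneg)
    then have "(\<integral>\<^sup>+ s. ennreal (min (f s) (real n)) \<partial>measure_pmf \<pi>) =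
        ennreal (measure_pmf.expectation \<pi> (\<lambda>s. min (f s) (real n)))"
      using nonneg by (intro nn_integral_eq_integral) auto
    then show ?thesis using bound by (simp add: ennreal_leI)
  qed
  then show "\<exists>N. \<forall>n\<ge>N. (\<integral>\<^sup>+ s. ennreal (min (f s) (real n)) \<partial>measure_pmf \<pi>) \<le> ennreal K"
    by blast
qed

text \<open>Each of the \<open>k + 1\<close> copies of \<open>r ^ k\<close> is at most one term of
  the geometric sum up to \<open>r ^ k\<close>, and that sum telescopes against
  \<open>1 - r\<close>.\<close>

lemma Suc_times_power_le:
  fixes r :: real
  assumes "0 \<le> r" "r \<le> 1"
  shows "real (Suc k) * r ^ k * (1 - r) \<le> 1"
proof -
  have "real (Suc k) * r ^ k = (\<Sum>i<Suc k. r ^ k)" by simp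
  also have "\<dots> \<le> (\<Sum>i<Suc k. r ^ i)"
    using assms by (intro sum_mono power_decreasing) auto
  finally have "real (Suc k) * r ^ k * (1 - r) \<le> (\<Sum>i<Suc k. r ^ i) * (1 - r)"
    using assms by (intro mult_right_mono) auto
  also have "\<dots> = 1 - r ^ Suc k"
    using one_diff_power_eq[of r "Suc k"] by (simp only: mult.commute)
  also have "\<dots> \<le> 1" using assms by (simp only: diff_le_eq) simp
  finally show ?thesis .
qed

text \<open>Negative reals are sent to \<open>0\<close> by \<open>ennreal\<close>, so it is
  subadditive for arbitrary signs.\<close>

lemma ennreal_add_le: "ennreal (x + y) \<le> ennreal x + ennreal y"
proof -
  have "ennreal (x + y) \<le> ennreal (max 0 x + max 0 y)"
    by (rule ennreal_leI) simp
  also have "\<dots> = ennreal (max 0 x) + ennreal (max 0 y)"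
    by (rule ennreal_plus) simp_all
  finally show ?thesis by simp
qed

subsection \<open>The chain for fixed \<open>pH\<close>\<close>

locale bilateral_match_E_stationary =
  fixes lamH lamE pE pH :: real and \<pi> :: "(nat \<times> nat) pmf"
  assumes lamH_pos: "0 < lamH" and lamE_pos: "0 < lamE"
    and pE_pos: "0 < pE" and pE_le_1: "pE \<le> 1" and pH_pos: "0 < pH" and pH_less_1: "pH < 1"
    and stationary: "stationary_distribution (bilateral_match_E_rate lamH lamE pE pH) \<pi>"
begin

abbreviation expect :: "(nat \<times> nat \<Rightarrow> real) \<Rightarrow> real" where
  "expect \<equiv> measure_pmf.expectation \<pi>"

text \<open>
  The probability that a new agent can form a 2-cycle with none of \<open>k\<close> waiting agents, by the
  two types.
\<close>

definition missHH :: "nat \<Rightarrow> real" where "missHH k = (1 - pH\<^sup>2) ^ k"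
definition missHE :: "nat \<Rightarrow> real" where "missHE k = (1 - pE * pH) ^ k"
definition missEE :: "nat \<Rightarrow> real" where "missEE k = (1 - pE\<^sup>2) ^ k"

definition upH :: "nat \<times> nat \<Rightarrow> real" where
  "upH s = lamH * missHH (fst s) * missHE (snd s)"

definition downH :: "nat \<times> nat \<Rightarrow> real" where
  "downH s = lamH * missHE (snd s) * (1 - missHH (fst s)) + lamE * missEE (snd s) * (1 - missHE (fst s))"

definition upE :: "nat \<times> nat \<Rightarrow> real" where
  "upE s = lamE * missHE (fst s) * missEE (snd s)"

definition downE :: "nat \<times> nat \<Rightarrow> real" where
  "downE s = lamH * (1 - missHE (snd s)) + lamE * (1 - missEE (snd s))"

lemma pEpH: "0 < pE * pH" "pE * pH < 1"
proof -
  show "0 < pE * pH" using pE_pos pH_pos by simp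
  show "pE * pH < 1"
    by (rule le_less_trans[OF mult_left_le_one_le]) (use pE_pos pE_le_1 pH_pos pH_less_1 in auto)
qed

lemma miss_bounds [simp]:
  "0 \<le> missHH k" "missHH k \<le> 1" "0 \<le> missHE k" "missHE k \<le> 1" "0 \<le> missEE k" "missEE k \<le> 1"
  using pEpH pE_pos pE_le_1 pH_pos pH_less_1
  by (auto simp: missHH_def missHE_def missEE_def power_le_one_iff abs_square_le_1
      intro!: zero_le_power power_le_one)

lemma miss_0 [simp]: "missHH 0 = 1" "missHE 0 = 1" "missEE 0 = 1"
  by (simp_all add: missHH_def missHE_def missEE_def)

lemma rates_nonneg: "0 \<le> upH s" "0 \<le> downH s" "0 \<le> upE s" "0 \<le> downE s"
  using lamH_pos lamE_pos by (simp_all add: upH_def downH_def upE_def downE_def)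

lemma upH_le: "upH s \<le> lamH"
  using mult_left_mono[of "missHH (fst s) * missHE (snd s)" 1 lamH] lamH_pos
  by (simp add: upH_def mult_le_one mult.assoc)

lemma upH_plus_downH_le: "upH s + downH s \<le> lamH + lamE"
proof -
  have "upH s + downH s = lamH * missHE (snd s) + lamE * (missEE (snd s) * (1 - missHE (fst s)))"
    by (simp add: upH_def downH_def algebra_simps)
  also have "\<dots> \<le> lamH * 1 + lamE * 1"
    using lamH_pos lamE_pos by (intro add_mono mult_left_mono mult_le_one) auto
  finally show ?thesis by simp
qed

lemma upE_plus_downE_le: "upE s + downE s \<le> lamH + 2 * lamE"
proof -
  have "lamE * (missHE (fst s) * missEE (snd s)) \<le> lamE * 1"
    using lamE_pos by (intro mult_left_mono mult_le_one) auto
  moreover have "lamH * (1 - missHE (snd s)) + lamE * (1 - missEE (snd s)) \<le> lamH * 1 + lamE * 1"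
    using lamH_pos lamE_pos by (intro add_mono mult_left_mono) auto
  ultimately show ?thesis by (simp add: upE_def downE_def mult.assoc)
qed

lemma downH_0: "fst s = 0 \<Longrightarrow> downH s = 0" and downE_0: "snd s = 0 \<Longrightarrow> downE s = 0"
  by (simp_all add: downH_def downE_def)

section \<open>Generator identity and cut equations\<close>

lemma expect_generator:
  assumes g: "integrable (measure_pmf \<pi>) g"
  shows "expect (\<lambda>s.
      upH s * (g (fst s + 1, snd s) - g s) + downH s * (g (fst s - 1, snd s) - g s) +
      upE s * (g (fst s, snd s + 1) - g s) + downE s * (g (fst s, snd s - 1) - g s)) = 0"
proof -
  define Q where "Q = bilateral_match_E_rate lamH lamE pE pH"
  \<comment> \<open>At \<open>h = 0\<close> or \<open>e = 0\<close> truncated subtraction turns a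
    lower neighbour into \<open>s\<close> itself. It contributes nothing, since
    \<open>Q s s = 0\<close>, and the matching term in \<open>sum_N\<close> vanishes because
    \<open>downH\<close> or \<open>downE\<close> is zero there.\<close>
  define N where "N s = {(fst s + 1, snd s), (fst s - 1, snd s), (fst s, snd s + 1),
    (fst s, snd s - 1)}" for s :: "nat \<times> nat"
  have Q_eq: "Q (h, e) (h', e') =
      (if h' = h + 1 \<and> e' = e then upH (h, e) else if h = h' + 1 \<and> e' = e then downH (h, e)
       else if h' = h \<and> e' = e + 1 then upE (h, e) else if h' = h \<and> e = e' + 1 then downE (h, e)
       else 0)" for h e h' e'
    by (simp add: Q_def bilateral_match_E_rate_def upH_def downH_def upE_def downE_def
        missHH_def missHE_def missEE_def)
  have sum_N: "(\<Sum>t\<in>N s. Q s t * F t) =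
      upH s * F (fst s + 1, snd s) + downH s * F (fst s - 1, snd s) +
      upE s * F (fst s, snd s + 1) + downE s * F (fst s, snd s - 1)" for s F
  proof (cases s)
    case (Pair h e)
    then show ?thesis
      by (cases h; cases e) (simp_all add: N_def Q_eq downH_0 downE_0 insert_absorb algebra_simps)
  qed
  have "expect (\<lambda>s. \<Sum>t\<in>N s. Q s t * (g t - g s)) = 0"
  proof (rule stationary_distribution_expectation_generator)
    show "stationary_distribution Q \<pi>" unfolding Q_def by (rule stationary)
    show "0 \<le> Q s t" for s t
      by (cases s; cases t) (simp add: Q_eq rates_nonneg)
    show "Q s s = 0" for s by (cases s) (simp add: Q_eq)
    show "finite (N s)" for s by (simp add: N_def)
    show "Q s t = 0" if "t \<notin> N s" for s t
      using that by (cases s; cases t) (auto simp: Q_eq N_def)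
    show "(\<Sum>t\<in>N s. Q s t) \<le> (lamH + lamE) + (lamH + 2 * lamE)" for s
      using sum_N[of s "\<lambda>_. 1"] upH_plus_downH_le[of s] upE_plus_downE_le[of s] by simp
  qed (rule g)
  then show ?thesis by (simp only: sum_N)
qed

text \<open>Test functions of \<open>h\<close> alone are unaffected by moves of \<open>e\<close>.
  For \<open>c\<close> the indicator of \<open>k\<close> this says that the flows across the cut
  between levels \<open>k\<close> and \<open>k + 1\<close> balance.\<close>

lemma expect_cut_H:
  assumes "\<And>k. \<bar>c k\<bar> \<le> B"
  shows "expect (\<lambda>s. c (fst s) * upH s) = expect (\<lambda>s. c (fst s - 1) * downH s)"
proof (rule expectation_cut_equation[where C = "lamH + lamE" and B = B])
  fix G :: "nat \<Rightarrow> real" assume "\<exists>B. \<forall>k. \<bar>G k\<bar> \<le> B"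
  then obtain B' where "\<And>k. \<bar>G k\<bar> \<le> B'" by blast
  then have "integrable (measure_pmf \<pi>) (\<lambda>s. G (fst s))"
    by (rule integrable_measure_pmf_bounded)
  from expect_generator[OF this]
  show "expect (\<lambda>s. upH s * (G (fst s + 1) - G (fst s)) + downH s * (G (fst s - 1) - G (fst s))) = 0"
    by simp
next
  show "\<bar>upH s\<bar> \<le> lamH + lamE" "\<bar>downH s\<bar> \<le> lamH + lamE" for s
    using upH_plus_downH_le[of s] rates_nonneg[of s] by linarith+
qed (use assms downH_0 in auto)

lemma expect_cut_E:
  assumes "\<And>k. \<bar>c k\<bar> \<le> B"
  shows "expect (\<lambda>s. c (snd s) * upE s) = expect (\<lambda>s. c (snd s - 1) * downE s)"
proof (rule expectation_cut_equation[where C = "lamH + 2 * lamE" and B = B])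
  fix G :: "nat \<Rightarrow> real" assume "\<exists>B. \<forall>k. \<bar>G k\<bar> \<le> B"
  then obtain B' where "\<And>k. \<bar>G k\<bar> \<le> B'" by blast
  then have "integrable (measure_pmf \<pi>) (\<lambda>s. G (snd s))"
    by (rule integrable_measure_pmf_bounded)
  from expect_generator[OF this]
  show "expect (\<lambda>s. upE s * (G (snd s + 1) - G (snd s)) + downE s * (G (snd s - 1) - G (snd s))) = 0"
    by simp
next
  show "\<bar>upE s\<bar> \<le> lamH + 2 * lamE" "\<bar>downE s\<bar> \<le> lamH + 2 * lamE" for s
    using upE_plus_downE_le[of s] rates_nonneg[of s] by linarith+
qed (use assms downE_0 in auto)

section \<open>A bound on the mean number of E agents, uniform in \<open>pH\<close>\<close>

text \<open>For \<open>e > 0\<close> the down rate is at least \<open>lamE * pE\<^sup>2\<close>,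
  while the up rate is at most \<open>lamE * (1 - pE\<^sup>2) ^ e\<close>; the cut equation with
  weight \<open>k + 1\<close> at level \<open>k\<close> compares the two. The bound does not involve
  \<open>pH\<close>, which keeps the later error terms small in the limit.\<close>

lemma nn_integral_snd_le: "(\<integral>\<^sup>+ s. ennreal (real (snd s)) \<partial>measure_pmf \<pi>) \<le> ennreal (1 / pE ^ 4)"
proof (rule nn_integral_le_of_min)
  fix n :: nat
  \<comment> \<open>The weight \<open>k + 1\<close>, truncated to be bounded. On the down side
    \<open>c (e - 1)\<close> is \<open>min e n\<close> for \<open>e > 0\<close>, and at
    \<open>e = 0\<close> the rate \<open>downE\<close> vanishes.\<close>
  define c where "c k = min (real (Suc k)) (real n)" for k
  have c: "0 \<le> c k" "c k \<le> real (Suc k)" "\<bar>c k\<bar> \<le> real n" for k by (auto simp: c_def)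
  have int: "integrable (measure_pmf \<pi>) (\<lambda>s. min (real (snd s)) (real n))"
    by (rule integrable_measure_pmf_bounded[where B = "real n"]) auto
  have "lamE * pE\<^sup>2 * expect (\<lambda>s. min (real (snd s)) (real n)) =
      expect (\<lambda>s. lamE * pE\<^sup>2 * min (real (snd s)) (real n))"
    by simp
  also have "\<dots> \<le> expect (\<lambda>s. c (snd s - 1) * downE s)"
  proof (rule integral_mono)
    show "integrable (measure_pmf \<pi>) (\<lambda>s. c (snd s - 1) * downE s)"
    proof (rule integrable_measure_pmf_bounded)
      show "\<bar>c (snd s - 1) * downE s\<bar> \<le> real n * (lamH + 2 * lamE)" for s
        using c upE_plus_downE_le[of s] rates_nonneg[of s] unfolding abs_mult
        by (intro mult_mono) auto
    qed
    show "lamE * pE\<^sup>2 * min (real (snd s)) (real n) \<le> c (snd s - 1) * downE s" for s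
    proof (cases "snd s")
      case 0
      then show ?thesis by (simp add: downE_0)
    next
      case (Suc k)
      have "missEE (Suc k) \<le> 1 - pE\<^sup>2"
        using pE_pos pE_le_1 power_decreasing[of 1 "Suc k" "1 - pE\<^sup>2"]
        by (simp add: missEE_def power_le_one abs_square_le_1)
      then have "lamE * pE\<^sup>2 \<le> lamE * (1 - missEE (Suc k))"
        using lamE_pos by (intro mult_left_mono) auto
      moreover have "0 \<le> lamH * (1 - missHE (Suc k))" using lamH_pos by simp
      ultimately have "lamE * pE\<^sup>2 \<le> downE s"
        by (simp add: downE_def Suc)
      then have "c k * (lamE * pE\<^sup>2) \<le> c k * downE s"
        using c by (intro mult_left_mono) auto
      then show ?thesis by (simp add: Suc c_def mult_ac)
    qed
  qed (use int in simp)
  also have "\<dots> = expect (\<lambda>s. c (snd s) * upE s)"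
    using expect_cut_E[of c, OF c(3)] by simp
  also have "\<dots> \<le> expect (\<lambda>s. lamE / pE\<^sup>2)"
  proof (rule integral_mono)
    show "integrable (measure_pmf \<pi>) (\<lambda>s. c (snd s) * upE s)"
    proof (rule integrable_measure_pmf_bounded)
      show "\<bar>c (snd s) * upE s\<bar> \<le> real n * (lamH + 2 * lamE)" for s
        using c upE_plus_downE_le[of s] rates_nonneg[of s] unfolding abs_mult
        by (intro mult_mono) auto
    qed
    show "c (snd s) * upE s \<le> lamE / pE\<^sup>2" for s
    proof -
      have "upE s \<le> lamE * missEE (snd s)"
        using lamE_pos by (simp add: upE_def mult_left_le_one_le mult.commute[of lamE] mult.assoc)
      then have "c (snd s) * upE s \<le> real (Suc (snd s)) * (lamE * missEE (snd s))"
        using c rates_nonneg by (intro mult_mono) auto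
      moreover have "real (Suc (snd s)) * missEE (snd s) * pE\<^sup>2 \<le> 1"
        using Suc_times_power_le[of "1 - pE\<^sup>2" "snd s"] pE_pos pE_le_1
        by (simp add: missEE_def power_le_one)
      then have "real (Suc (snd s)) * missEE (snd s) \<le> 1 / pE\<^sup>2"
        using pE_pos by (simp add: pos_le_divide_eq)
      then have "lamE * (real (Suc (snd s)) * missEE (snd s)) \<le> lamE * (1 / pE\<^sup>2)"
        using lamE_pos by (intro mult_left_mono) auto
      ultimately show ?thesis by (simp add: mult_ac)
    qed
  qed simp
  finally have "lamE * pE\<^sup>2 * expect (\<lambda>s. min (real (snd s)) (real n)) \<le> lamE / pE\<^sup>2"
    by simp
  then show "expect (\<lambda>s. min (real (snd s)) (real n)) \<le> 1 / pE ^ 4"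
    using lamE_pos pE_pos by (simp add: field_simps power2_eq_square power4_eq_xxxx)
qed simp

lemma integrable_snd: "integrable (measure_pmf \<pi>) (\<lambda>s. real (snd s))"
  using nn_integral_snd_le by (intro integrableI_bounded) (auto intro: le_less_trans)

lemma expect_snd_le: "expect (\<lambda>s. real (snd s)) \<le> 1 / pE ^ 4"
proof -
  have "ennreal (expect (\<lambda>s. real (snd s))) \<le> ennreal (1 / pE ^ 4)"
    using nn_integral_snd_le nn_integral_eq_integral[OF integrable_snd] by simp
  then show ?thesis using pE_pos by (simp add: ennreal_le_iff)
qed

section \<open>Averaging out the fast E-component\<close>

lemma integrable_weighted:
  fixes \<psi> :: "nat \<Rightarrow> real" and X :: "nat \<times> nat \<Rightarrow> real"
  assumes "\<And>k. \<bar>\<psi> k\<bar> \<le> B" "\<And>s. \<bar>X s\<bar> \<le> C"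
  shows "integrable (measure_pmf \<pi>) (\<lambda>s. \<psi> (fst s) * X s)"
proof (rule integrable_measure_pmf_bounded)
  show "\<bar>\<psi> (fst s) * X s\<bar> \<le> B * C" for s
    using assms order_trans[OF abs_ge_zero assms(1)] unfolding abs_mult
    by (intro mult_mono) auto
qed

lemma integrable_weights:
  fixes \<psi> :: "nat \<Rightarrow> real"
  assumes \<psi>: "\<And>k. \<bar>\<psi> k\<bar> \<le> B"
  shows "integrable (measure_pmf \<pi>) (\<lambda>s. \<psi> (fst s))"
    and "integrable (measure_pmf \<pi>) (\<lambda>s. \<psi> (fst s) * (1 - missHE (snd s)))"
    and "integrable (measure_pmf \<pi>) (\<lambda>s. \<psi> (fst s) * (missEE (snd s) * (1 + missHE (fst s))))"
    and "integrable (measure_pmf \<pi>) (\<lambda>s. \<psi> (fst s) * downH s)"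
    and "integrable (measure_pmf \<pi>) (\<lambda>s. \<psi> (fst s) * upH s)"
proof -
  show "integrable (measure_pmf \<pi>) (\<lambda>s. \<psi> (fst s))"
    by (rule integrable_measure_pmf_bounded[OF \<psi>])
  show "integrable (measure_pmf \<pi>) (\<lambda>s. \<psi> (fst s) * (1 - missHE (snd s)))"
    using miss_bounds by (intro integrable_weighted[OF \<psi>, where C = 1]) (simp add: abs_le_iff)
  show "integrable (measure_pmf \<pi>) (\<lambda>s. \<psi> (fst s) * (missEE (snd s) * (1 + missHE (fst s))))"
  proof (rule integrable_weighted[OF \<psi>])
    show "\<bar>missEE (snd s) * (1 + missHE (fst s))\<bar> \<le> 1 * 2" for s :: "nat \<times> nat"
      unfolding abs_mult by (intro mult_mono) auto
  qed
  show "integrable (measure_pmf \<pi>) (\<lambda>s. \<psi> (fst s) * downH s)"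
    "integrable (measure_pmf \<pi>) (\<lambda>s. \<psi> (fst s) * upH s)"
    using upH_plus_downH_le rates_nonneg
    by (intro integrable_weighted[OF \<psi>, where C = "lamH + lamE"]; smt (verit))+
qed

text \<open>
  Stationarity tested against \<open>\<psi> h * e\<close>: up to the order of the Lipschitz constant of \<open>\<psi>\<close>, the
  up and down flows of the E-component balance even for fixed \<open>h\<close>.
\<close>

lemma expect_missEE_averaging:
  fixes \<psi> :: "nat \<Rightarrow> real"
  assumes bdd: "\<And>k. \<bar>\<psi> k\<bar> \<le> B" and lip: "\<And>k. \<bar>\<psi> (Suc k) - \<psi> k\<bar> \<le> \<theta>"
  shows "\<bar>lamE * expect (\<lambda>s. \<psi> (fst s) * (missEE (snd s) * (1 + missHE (fst s))))
      - lamE * expect (\<lambda>s. \<psi> (fst s)) - lamH * expect (\<lambda>s. \<psi> (fst s) * (1 - missHE (snd s)))\<bar>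
    \<le> \<theta> * (lamH + lamE) / pE ^ 4"
proof -
  have \<theta>: "0 \<le> \<theta>" using order_trans[OF abs_ge_zero lip] .
  have B: "0 \<le> B" using order_trans[OF abs_ge_zero bdd] .
  \<comment> \<open>This test function is unbounded in \<open>e\<close>; it is integrable because
    the mean of \<open>e\<close> is finite.\<close>
  define g where "g s = \<psi> (fst s) * real (snd s)" for s :: "nat \<times> nat"
  have int_g: "integrable (measure_pmf \<pi>) g"
  proof (rule Bochner_Integration.integrable_bound)
    show "integrable (measure_pmf \<pi>) (\<lambda>s. B * real (snd s))"
      using integrable_snd by simp
    show "AE s in measure_pmf \<pi>. norm (g s) \<le> norm (B * real (snd s))"
      using bdd B by (intro AE_I2) (auto simp: g_def abs_mult intro!: mult_right_mono)
  qed simp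
  \<comment> \<open>The part of the generator due to moves of \<open>h\<close>. Such a move changes
    \<open>\<psi>\<close> by at most \<open>\<theta>\<close>, so \<open>R\<close> is of order
    \<open>\<theta> * e\<close>, with mean controlled by \<open>expect_snd_le\<close>.\<close>
  define R where "R s = real (snd s) *
    (upH s * (\<psi> (fst s + 1) - \<psi> (fst s)) + downH s * (\<psi> (fst s - 1) - \<psi> (fst s)))" for s
  have R: "\<bar>R s\<bar> \<le> \<theta> * (lamH + lamE) * real (snd s)" for s
  proof -
    have "\<bar>\<psi> (fst s - 1) - \<psi> (fst s)\<bar> \<le> \<theta>"
      using lip[of "fst s - 1"] \<theta> by (cases "fst s") (auto simp: abs_minus_commute)
    moreover have "\<bar>\<psi> (fst s + 1) - \<psi> (fst s)\<bar> \<le> \<theta>" using lip[of "fst s"] by simp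
    ultimately have "\<bar>upH s * (\<psi> (fst s + 1) - \<psi> (fst s)) + downH s * (\<psi> (fst s - 1) - \<psi> (fst s))\<bar>
        \<le> upH s * \<theta> + downH s * \<theta>"
      using rates_nonneg[of s]
      by (intro order.trans[OF abs_triangle_ineq] add_mono) (auto simp: abs_mult intro!: mult_left_mono)
    also have "\<dots> \<le> (lamH + lamE) * \<theta>"
      using mult_right_mono[OF upH_plus_downH_le[of s] \<theta>] by (simp add: algebra_simps)
    finally have "real (snd s) * \<bar>upH s * (\<psi> (fst s + 1) - \<psi> (fst s)) +
        downH s * (\<psi> (fst s - 1) - \<psi> (fst s))\<bar> \<le> real (snd s) * ((lamH + lamE) * \<theta>)"
      by (rule mult_left_mono) simp
    then show ?thesis unfolding R_def abs_mult by (simp add: mult_ac)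
  qed
  have int_bound: "integrable (measure_pmf \<pi>) (\<lambda>s. \<theta> * (lamH + lamE) * real (snd s))"
    using integrable_snd by simp
  have int_R: "integrable (measure_pmf \<pi>) R"
    by (rule Bochner_Integration.integrable_bound[OF int_bound])
      (use R in \<open>auto intro!: AE_I2 order.trans[OF R]\<close>)
  have "\<bar>expect R\<bar> \<le> expect (\<lambda>s. \<bar>R s\<bar>)" by (rule integral_abs_bound)
  also have "\<dots> \<le> expect (\<lambda>s. \<theta> * (lamH + lamE) * real (snd s))"
    by (rule integral_mono) (use int_R int_bound R in auto)
  also have "\<dots> = \<theta> * (lamH + lamE) * expect (\<lambda>s. real (snd s))"
    by simp
  also have "\<dots> \<le> \<theta> * (lamH + lamE) * (1 / pE ^ 4)"
    using \<theta> lamH_pos lamE_pos expect_snd_le by (intro mult_left_mono) auto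
  finally have ER: "\<bar>expect R\<bar> \<le> \<theta> * (lamH + lamE) / pE ^ 4" by simp
  \<comment> \<open>The part due to moves of \<open>e\<close>:
    \<open>\<psi> h * (upE - downE)\<close>, with the two \<open>missEE\<close> terms collected into
    the factor \<open>1 + missHE h\<close>.\<close>
  define T where "T s = lamE * (\<psi> (fst s) * (missEE (snd s) * (1 + missHE (fst s))))
    - lamE * \<psi> (fst s) - lamH * (\<psi> (fst s) * (1 - missHE (snd s)))" for s
  have i1: "integrable (measure_pmf \<pi>) (\<lambda>s. lamE * (\<psi> (fst s) * (missEE (snd s) * (1 + missHE (fst s)))))"
    by (rule integrable_mult_right) (rule integrable_weights(3)[OF bdd])
  have i2: "integrable (measure_pmf \<pi>) (\<lambda>s. lamE * \<psi> (fst s))"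
    by (rule integrable_mult_right) (rule integrable_weights(1)[OF bdd])
  have i3: "integrable (measure_pmf \<pi>) (\<lambda>s. lamH * (\<psi> (fst s) * (1 - missHE (snd s))))"
    by (rule integrable_mult_right) (rule integrable_weights(2)[OF bdd])
  have int_T: "integrable (measure_pmf \<pi>) T"
    unfolding T_def using i1 i2 i3 by (intro Bochner_Integration.integrable_diff)
  have "R s + T s = upH s * (g (fst s + 1, snd s) - g s) + downH s * (g (fst s - 1, snd s) - g s) +
      upE s * (g (fst s, snd s + 1) - g s) + downE s * (g (fst s, snd s - 1) - g s)" for s
  proof -
    have "downE s * (real (snd s - 1) - real (snd s)) = - downE s"
      by (cases "snd s") (simp_all add: downE_0 algebra_simps)
    then have "downE s * (g (fst s, snd s - 1) - g s) = - \<psi> (fst s) * downE s"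
      by (simp add: g_def right_diff_distrib[symmetric] mult.left_commute)
    moreover have "upE s * (g (fst s, snd s + 1) - g s) = \<psi> (fst s) * upE s"
      by (simp add: g_def algebra_simps)
    ultimately show ?thesis
      by (simp add: R_def T_def g_def upE_def downE_def algebra_simps)
  qed
  then have "expect (\<lambda>s. R s + T s) = 0"
    using expect_generator[OF int_g] by presburger
  then have "expect R + expect T = 0"
    by (simp only: Bochner_Integration.integral_add[OF int_R int_T])
  moreover have "expect T = lamE * expect (\<lambda>s. \<psi> (fst s) * (missEE (snd s) * (1 + missHE (fst s))))
      - lamE * expect (\<lambda>s. \<psi> (fst s)) - lamH * expect (\<lambda>s. \<psi> (fst s) * (1 - missHE (snd s)))"
    unfolding T_def
    by (simp only: Bochner_Integration.integral_diff[OF Bochner_Integration.integrable_diff[OF i1 i2] i3]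
        Bochner_Integration.integral_diff[OF i1 i2] integral_mult_right_zero)
  ultimately show ?thesis using ER by linarith
qed

section \<open>Drift estimates above and below the equilibrium level of \<open>h\<close>\<close>

text \<open>With \<open>w = missHE e\<close> and \<open>z = missEE e\<close>, the downward drift of
  \<open>h\<close> is \<open>lamH * w * (1 - 2 * missHH h) + lamE * z * (1 - missHE h)\<close>.
  Above level \<open>M\<close> it is at least
  \<open>lamH * w * (1 - 2 * v) + \<eta> * lamE * z * (1 + missHE h)\<close>, and the averaging
  lemma evaluates the weighted mean of the last term up to an error of order
  \<open>\<theta>\<close>. The resulting lower bound \<open>\<kappa>\<close> times the mean weight
  is confronted with the cut equation.\<close>

lemma expect_H_minus_le:
  fixes \<theta> M v y \<kappa> :: real
  defines "\<eta> \<equiv> (1 - y) / (1 + y)"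
  assumes \<theta>: "0 < \<theta>" and M: "0 \<le> M" and y: "0 \<le> y" "y \<le> 1"
    and HH: "\<And>h. M < \<theta> * real h \<Longrightarrow> missHH h \<le> v"
    and HE: "\<And>h. M < \<theta> * real h \<Longrightarrow> missHE h \<le> y"
    and \<kappa>: "0 < \<kappa>" "\<kappa> \<le> \<eta> * (lamH + lamE)" "\<kappa> \<le> lamH * (1 - 2 * v) + \<eta> * lamE"
  shows "(\<integral>\<^sup>+ s. ennreal (max 0 (\<theta> * real (fst s) - M)) \<partial>measure_pmf \<pi>)
    \<le> ennreal (((lamH + (lamH + lamE) / pE ^ 4) / \<kappa> + 1) * \<theta>)"
proof (rule nn_integral_le_of_min)
  fix n :: nat
  define K where "K = (lamH + lamE) / pE ^ 4"
  have K: "0 \<le> K" using lamH_pos lamE_pos pE_pos by (simp add: K_def)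
  have \<eta>: "0 \<le> \<eta>" "\<eta> \<le> 1" using y by (simp_all add: \<eta>_def)
  \<comment> \<open>The truncation at \<open>n\<close> only makes the weight bounded; the final
    estimate is free of \<open>n\<close>. The cut equation weights down moves by
    \<open>c (h - 1)\<close>, hence the shifted copy \<open>\<psi>\<close>, and passing between the
    two costs at most \<open>\<theta>\<close>.\<close>
  define \<phi> where "\<phi> k = min (max 0 (\<theta> * real k - M)) (real n)" for k
  define \<psi> where "\<psi> k = \<phi> (k - 1)" for k
  have \<phi>0: "0 \<le> \<phi> k" "\<bar>\<phi> k\<bar> \<le> real n" for k by (auto simp: \<phi>_def)
  have \<psi>0: "0 \<le> \<psi> k" "\<bar>\<psi> k\<bar> \<le> real n" for k using \<phi>0 by (auto simp: \<psi>_def)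
  have step: "\<phi> k \<le> \<phi> (Suc k)" "\<phi> (Suc k) \<le> \<phi> k + \<theta>" for k
    using \<theta> by (auto simp: \<phi>_def algebra_simps)
  have \<phi>\<psi>: "\<phi> k \<le> \<psi> k + \<theta>" for k
    using step \<theta> by (cases k) (auto simp: \<psi>_def)
  have lip: "\<bar>\<psi> (Suc k) - \<psi> k\<bar> \<le> \<theta>" for k
    using step[of "k - 1"] \<theta> by (cases k) (auto simp: \<psi>_def abs_le_iff)
  have supp: "M < \<theta> * real k" if "\<psi> k \<noteq> 0" for k
  proof -
    have "M < \<theta> * real (k - 1)" using that by (auto simp: \<psi>_def \<phi>_def split: if_splits)
    also have "\<dots> \<le> \<theta> * real k" using \<theta> by simp
    finally show ?thesis .
  qed
  define P where "P = expect (\<lambda>s. \<psi> (fst s))"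
  define W where "W = expect (\<lambda>s. \<psi> (fst s) * (1 - missHE (snd s)))"
  define Z where "Z = expect (\<lambda>s. \<psi> (fst s) * (missEE (snd s) * (1 + missHE (fst s))))"
  note int = integrable_weights[of \<psi> "real n", OF \<psi>0(2)]
  note iP = int(1) and iW = int(2) and iZ = int(3) and iD = int(4) and iU = int(5)
  note i\<phi> = integrable_weights(1)[of \<phi> "real n", OF \<phi>0(2)]
    and i\<phi>U = integrable_weights(5)[of \<phi> "real n", OF \<phi>0(2)]
  have W: "0 \<le> W" "W \<le> P"
  proof -
    show "0 \<le> W" unfolding W_def by (rule integral_nonneg_AE) (simp add: \<psi>0)
    show "W \<le> P" unfolding W_def P_def
    proof (rule integral_mono[OF iW iP])
      show "\<psi> (fst s) * (1 - missHE (snd s)) \<le> \<psi> (fst s)" for s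
        using mult_left_mono[of "1 - missHE (snd s)" 1 "\<psi> (fst s)"] \<psi>0 by simp
    qed
  qed
  have avg: "lamE * P + lamH * W - \<theta> * K \<le> lamE * Z"
    using expect_missEE_averaging[of \<psi> "real n" \<theta>, OF \<psi>0(2) lip]
    by (simp add: P_def W_def Z_def K_def abs_le_iff)
  have "expect (\<lambda>s. \<psi> (fst s) * downH s) = expect (\<lambda>s. \<phi> (fst s) * upH s)"
    using expect_cut_H[of \<phi> "real n", OF \<phi>0(2)] by (simp add: \<psi>_def)
  also have "\<dots> \<le> expect (\<lambda>s. \<psi> (fst s) * upH s + \<theta> * lamH)"
  proof (rule integral_mono[OF i\<phi>U])
    show "\<phi> (fst s) * upH s \<le> \<psi> (fst s) * upH s + \<theta> * lamH" for s
    proof -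
      have "\<phi> (fst s) * upH s \<le> (\<psi> (fst s) + \<theta>) * upH s"
        using \<phi>\<psi> rates_nonneg by (intro mult_right_mono) auto
      also have "\<theta> * upH s \<le> \<theta> * lamH"
        using \<theta> upH_le by (intro mult_left_mono) auto
      then have "(\<psi> (fst s) + \<theta>) * upH s \<le> \<psi> (fst s) * upH s + \<theta> * lamH"
        by (simp add: algebra_simps)
      finally show ?thesis .
    qed
  qed (intro Bochner_Integration.integrable_add iU measure_pmf.integrable_const)
  also have "\<dots> = expect (\<lambda>s. \<psi> (fst s) * upH s) + \<theta> * lamH"
    by (subst Bochner_Integration.integral_add[OF iU]) simp_all
  finally have cut: "expect (\<lambda>s. \<psi> (fst s) * downH s) \<le> expect (\<lambda>s. \<psi> (fst s) * upH s) + \<theta> * lamH" .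
  define a where "a = lamH * (1 - 2 * v)"
  have "a * P - a * W + \<eta> * lamE * Z =
      expect (\<lambda>s. a * \<psi> (fst s) - a * (\<psi> (fst s) * (1 - missHE (snd s))) +
        \<eta> * lamE * (\<psi> (fst s) * (missEE (snd s) * (1 + missHE (fst s)))))"
    unfolding P_def W_def Z_def using iP iW iZ by simp
  also have "\<dots> \<le> expect (\<lambda>s. \<psi> (fst s) * downH s - \<psi> (fst s) * upH s)"
  proof (rule integral_mono)
    show "a * \<psi> (fst s) - a * (\<psi> (fst s) * (1 - missHE (snd s))) +
        \<eta> * lamE * (\<psi> (fst s) * (missEE (snd s) * (1 + missHE (fst s))))
      \<le> \<psi> (fst s) * downH s - \<psi> (fst s) * upH s" for s
    proof (cases "\<psi> (fst s) = 0")
      case False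
      let ?w = "missHE (snd s)" and ?z = "missEE (snd s)"
      let ?y = "missHE (fst s)" and ?v = "missHH (fst s)"
      have "?v \<le> v" "?y \<le> y" using HH HE supp False by auto
      \<comment> \<open>The map from \<open>t\<close> to \<open>(1 - t) / (1 + t)\<close> is
        decreasing.\<close>
      then have "\<eta> * (1 + ?y) \<le> 1 - ?y"
      proof -
        have "(1 - y) * (1 + ?y) \<le> (1 - ?y) * (1 + y)"
          using \<open>?y \<le> y\<close> by (simp add: algebra_simps)
        then show ?thesis using y by (simp add: \<eta>_def field_simps)
      qed
      then have "lamE * ?z * (\<eta> * (1 + ?y)) \<le> lamE * ?z * (1 - ?y)"
        using lamE_pos by (intro mult_left_mono) auto
      moreover have "lamH * ?w * (1 - 2 * v) \<le> lamH * ?w * (1 - 2 * ?v)"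
        using \<open>?v \<le> v\<close> lamH_pos by (intro mult_left_mono) auto
      ultimately have "lamH * ?w * (1 - 2 * v) + lamE * ?z * (\<eta> * (1 + ?y)) \<le> downH s - upH s"
        by (simp add: downH_def upH_def algebra_simps)
      then have "\<psi> (fst s) * (lamH * ?w * (1 - 2 * v) + lamE * ?z * (\<eta> * (1 + ?y)))
          \<le> \<psi> (fst s) * (downH s - upH s)"
        using \<psi>0 by (intro mult_left_mono) auto
      then show ?thesis by (simp add: a_def algebra_simps)
    qed simp
  qed (use iP iW iZ iD iU in simp_all)
  also have "\<dots> = expect (\<lambda>s. \<psi> (fst s) * downH s) - expect (\<lambda>s. \<psi> (fst s) * upH s)"
    by (rule Bochner_Integration.integral_diff[OF iD iU])
  also have "\<dots> \<le> \<theta> * lamH" using cut by simp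
  finally have drift: "a * P - a * W + \<eta> * lamE * Z \<le> \<theta> * lamH" .
  \<comment> \<open>The weight is split according to \<open>w\<close> and \<open>1 - w\<close>.
    Averaging gives the first share the coefficient \<open>a + \<eta> * lamE\<close> and the second
    \<open>\<eta> * (lamH + lamE)\<close>; \<open>\<kappa>\<close> is below both. No smallness of
    \<open>W\<close> is claimed here, as the weights are not bounded uniformly in
    \<open>n\<close>.\<close>
  have "\<kappa> * P = \<kappa> * (P - W) + \<kappa> * W" by (simp add: algebra_simps)
  also have "\<dots> \<le> (a + \<eta> * lamE) * (P - W) + \<eta> * (lamH + lamE) * W"
    using W \<kappa> by (intro add_mono mult_right_mono) (auto simp: a_def)
  also have "\<dots> = a * P - a * W + \<eta> * (lamE * P + lamH * W - \<theta> * K) + \<eta> * (\<theta> * K)"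
    by (simp add: algebra_simps)
  also have "\<dots> \<le> a * P - a * W + \<eta> * (lamE * Z) + 1 * (\<theta> * K)"
    using avg \<eta> \<theta> K by (intro add_mono mult_left_mono mult_right_mono) auto
  also have "\<dots> \<le> (lamH + K) * \<theta>" using drift by (simp add: algebra_simps)
  finally have "P \<le> (lamH + K) / \<kappa> * \<theta>"
    using \<kappa> by (simp add: field_simps)
  moreover have "expect (\<lambda>s. \<phi> (fst s)) \<le> expect (\<lambda>s. \<psi> (fst s) + \<theta>)"
    by (rule integral_mono[OF i\<phi>]) (use iP \<phi>\<psi> in simp_all)
  then have "expect (\<lambda>s. \<phi> (fst s)) \<le> P + \<theta>"
    using iP by (simp add: P_def)
  ultimately show "expect (\<lambda>s. min (max 0 (\<theta> * real (fst s) - M)) (real n))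
      \<le> ((lamH + (lamH + lamE) / pE ^ 4) / \<kappa> + 1) * \<theta>"
    by (simp add: \<phi>_def K_def algebra_simps)
qed simp

text \<open>The mirror image below level \<open>m\<close>, where the averaged downward drift is at
  most \<open>- \<kappa>\<close>. Now the weight is bounded by \<open>m\<close>, so \<open>W\<close>
  is of order \<open>pH\<close> and becomes an error term. The hypotheses mention
  \<open>h - 1\<close> because the shifted weight \<open>\<psi> h\<close> is nonzero exactly for
  such \<open>h\<close>.\<close>

lemma expect_minus_H_le:
  fixes \<theta> m v y :: real
  defines "\<eta> \<equiv> (1 - y) / (1 + y)"
  defines "\<kappa> \<equiv> 2 * lamH * v - lamH - \<eta> * lamE"
  assumes \<theta>: "0 < \<theta>" and m: "0 < m" and y: "0 \<le> y"
    and HH: "\<And>h. \<theta> * real (h - 1) < m \<Longrightarrow> v \<le> missHH h"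
    and HE: "\<And>h. \<theta> * real (h - 1) < m \<Longrightarrow> y \<le> missHE h"
    and \<kappa>: "0 < \<kappa>"
  shows "expect (\<lambda>s. max 0 (m - \<theta> * real (fst s)))
    \<le> ((lamH + (lamH + lamE) / pE ^ 4) * \<theta> + 2 * lamH * m * pE * pH / pE ^ 4) / \<kappa>"
proof -
  define K where "K = (lamH + lamE) / pE ^ 4"
  have K: "0 \<le> K" using lamH_pos lamE_pos pE_pos by (simp add: K_def)
  \<comment> \<open>Since \<open>m > 0\<close>, the level \<open>h = 0\<close> lies in the range of
    both hypotheses, and all miss probabilities are \<open>1\<close> there.\<close>
  have y1: "y \<le> 1" and v1: "v \<le> 1" using HE[of 0] HH[of 0] m by auto
  have \<eta>: "0 \<le> \<eta>" "\<eta> \<le> 1" using y y1 by (simp_all add: \<eta>_def)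
  define \<phi> where "\<phi> k = max 0 (m - \<theta> * real k)" for k
  define \<psi> where "\<psi> k = \<phi> (k - 1)" for k
  have \<phi>0: "0 \<le> \<phi> k" "\<bar>\<phi> k\<bar> \<le> m" for k using m \<theta> by (auto simp: \<phi>_def)
  have \<psi>0: "0 \<le> \<psi> k" "\<bar>\<psi> k\<bar> \<le> m" for k using \<phi>0 by (auto simp: \<psi>_def)
  have step: "\<phi> (Suc k) \<le> \<phi> k" "\<phi> k \<le> \<phi> (Suc k) + \<theta>" for k
    using \<theta> by (auto simp: \<phi>_def algebra_simps)
  have \<phi>\<psi>: "\<psi> k \<le> \<phi> k + \<theta>" "\<phi> k \<le> \<psi> k" for k
    using step \<theta> by (cases k; auto simp: \<psi>_def)+
  have lip: "\<bar>\<psi> (Suc k) - \<psi> k\<bar> \<le> \<theta>" for k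
    using step[of "k - 1"] \<theta> by (cases k) (auto simp: \<psi>_def abs_le_iff)
  have supp: "\<theta> * real (k - 1) < m" if "\<psi> k \<noteq> 0" for k
    using that by (auto simp: \<psi>_def \<phi>_def split: if_splits)
  define P where "P = expect (\<lambda>s. \<psi> (fst s))"
  define W where "W = expect (\<lambda>s. \<psi> (fst s) * (1 - missHE (snd s)))"
  define Z where "Z = expect (\<lambda>s. \<psi> (fst s) * (missEE (snd s) * (1 + missHE (fst s))))"
  note int = integrable_weights[of \<psi> m, OF \<psi>0(2)]
  note iP = int(1) and iW = int(2) and iZ = int(3) and iD = int(4) and iU = int(5)
  note i\<phi> = integrable_weights(1)[of \<phi> m, OF \<phi>0(2)]
    and i\<phi>U = integrable_weights(5)[of \<phi> m, OF \<phi>0(2)]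
  have W0: "0 \<le> W" unfolding W_def by (rule integral_nonneg_AE) (simp add: \<psi>0)
  have "W \<le> expect (\<lambda>s. m * (pE * pH) * real (snd s))"
    unfolding W_def
  proof (rule integral_mono[OF iW])
    show "\<psi> (fst s) * (1 - missHE (snd s)) \<le> m * (pE * pH) * real (snd s)" for s
    proof -
      \<comment> \<open>A union bound over the \<open>e\<close> waiting agents, in the form of
        Bernoulli's inequality.\<close>
      have "1 - missHE (snd s) \<le> pE * pH * real (snd s)"
        using Bernoulli_inequality[of "- (pE * pH)" "snd s"] pEpH by (simp add: missHE_def mult.commute)
      then have "\<psi> (fst s) * (1 - missHE (snd s)) \<le> m * (pE * pH * real (snd s))"
        using \<psi>0[of "fst s"] m by (intro mult_mono) auto
      then show ?thesis by (simp add: mult.assoc)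
    qed
  qed (use integrable_snd in simp)
  also have "\<dots> = m * (pE * pH) * expect (\<lambda>s. real (snd s))" by simp
  also have "\<dots> \<le> m * (pE * pH) * (1 / pE ^ 4)"
    using m pEpH expect_snd_le by (intro mult_left_mono) auto
  finally have W1: "W \<le> m * pE * pH / pE ^ 4" by simp
  have avg: "lamE * Z \<le> lamE * P + lamH * W + \<theta> * K"
    using expect_missEE_averaging[of \<psi> m \<theta>, OF \<psi>0(2) lip]
    by (simp add: P_def W_def Z_def K_def abs_le_iff)
  have "expect (\<lambda>s. \<psi> (fst s) * upH s) \<le> expect (\<lambda>s. \<phi> (fst s) * upH s + \<theta> * lamH)"
  proof (rule integral_mono[OF iU])
    show "\<psi> (fst s) * upH s \<le> \<phi> (fst s) * upH s + \<theta> * lamH" for s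
    proof -
      have "\<psi> (fst s) * upH s \<le> (\<phi> (fst s) + \<theta>) * upH s"
        using \<phi>\<psi> rates_nonneg by (intro mult_right_mono) auto
      also have "\<theta> * upH s \<le> \<theta> * lamH"
        using \<theta> upH_le by (intro mult_left_mono) auto
      then have "(\<phi> (fst s) + \<theta>) * upH s \<le> \<phi> (fst s) * upH s + \<theta> * lamH"
        by (simp add: algebra_simps)
      finally show ?thesis .
    qed
  qed (intro Bochner_Integration.integrable_add i\<phi>U measure_pmf.integrable_const)
  also have "\<dots> = expect (\<lambda>s. \<phi> (fst s) * upH s) + \<theta> * lamH"
    by (subst Bochner_Integration.integral_add[OF i\<phi>U]) simp_all
  also have "expect (\<lambda>s. \<phi> (fst s) * upH s) = expect (\<lambda>s. \<psi> (fst s) * downH s)"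
    using expect_cut_H[of \<phi> m, OF \<phi>0(2)] by (simp add: \<psi>_def)
  finally have cut: "expect (\<lambda>s. \<psi> (fst s) * upH s) \<le> expect (\<lambda>s. \<psi> (fst s) * downH s) + \<theta> * lamH" .
  define a where "a = lamH * (1 - 2 * v)"
  have "- (\<theta> * lamH) \<le> expect (\<lambda>s. \<psi> (fst s) * downH s) - expect (\<lambda>s. \<psi> (fst s) * upH s)"
    using cut by simp
  also have "\<dots> = expect (\<lambda>s. \<psi> (fst s) * downH s - \<psi> (fst s) * upH s)"
    by (rule Bochner_Integration.integral_diff[OF iD iU, symmetric])
  also have "\<dots> \<le> expect (\<lambda>s. a * \<psi> (fst s) - a * (\<psi> (fst s) * (1 - missHE (snd s))) +
        \<eta> * lamE * (\<psi> (fst s) * (missEE (snd s) * (1 + missHE (fst s)))))"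
  proof (rule integral_mono)
    show "\<psi> (fst s) * downH s - \<psi> (fst s) * upH s
      \<le> a * \<psi> (fst s) - a * (\<psi> (fst s) * (1 - missHE (snd s))) +
        \<eta> * lamE * (\<psi> (fst s) * (missEE (snd s) * (1 + missHE (fst s))))" for s
    proof (cases "\<psi> (fst s) = 0")
      case False
      let ?w = "missHE (snd s)" and ?z = "missEE (snd s)"
      let ?y = "missHE (fst s)" and ?v = "missHH (fst s)"
      have "v \<le> ?v" "y \<le> ?y" using HH HE supp False by auto
      then have "1 - ?y \<le> \<eta> * (1 + ?y)"
      proof -
        have "(1 - ?y) * (1 + y) \<le> (1 - y) * (1 + ?y)"
          using \<open>y \<le> ?y\<close> by (simp add: algebra_simps)
        then show ?thesis using y by (simp add: \<eta>_def field_simps)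
      qed
      then have "lamE * ?z * (1 - ?y) \<le> lamE * ?z * (\<eta> * (1 + ?y))"
        using lamE_pos by (intro mult_left_mono) auto
      moreover have "lamH * ?w * (1 - 2 * ?v) \<le> lamH * ?w * (1 - 2 * v)"
        using \<open>v \<le> ?v\<close> lamH_pos by (intro mult_left_mono) auto
      ultimately have "downH s - upH s \<le> lamH * ?w * (1 - 2 * v) + lamE * ?z * (\<eta> * (1 + ?y))"
        by (simp add: downH_def upH_def algebra_simps)
      then have "\<psi> (fst s) * (downH s - upH s)
          \<le> \<psi> (fst s) * (lamH * ?w * (1 - 2 * v) + lamE * ?z * (\<eta> * (1 + ?y)))"
        using \<psi>0 by (intro mult_left_mono) auto
      then show ?thesis by (simp add: a_def algebra_simps)
    qed simp
  qed (use iP iW iZ iD iU in simp_all)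
  also have "\<dots> = a * P - a * W + \<eta> * lamE * Z"
    unfolding P_def W_def Z_def using iP iW iZ by simp
  finally have drift: "- (\<theta> * lamH) \<le> a * P - a * W + \<eta> * (lamE * Z)" by simp
  also have "\<dots> \<le> a * P - a * W + \<eta> * (lamE * P + lamH * W + \<theta> * K)"
    using avg \<eta> by (intro add_left_mono mult_left_mono) auto
  also have "\<dots> = - (\<kappa> * P) + (\<eta> * lamH - a) * W + \<eta> * (\<theta> * K)"
    by (simp add: \<kappa>_def a_def algebra_simps)
  also have "\<dots> \<le> - (\<kappa> * P) + (2 * lamH) * W + 1 * (\<theta> * K)"
  proof -
    have "\<eta> * lamH \<le> 1 * lamH" "lamH * v \<le> lamH * 1"
      using \<eta> v1 lamH_pos by (auto intro: mult_right_mono mult_left_mono)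
    then have "\<eta> * lamH - a \<le> 2 * lamH" by (simp add: a_def algebra_simps)
    then show ?thesis
      using W0 \<eta> \<theta> K by (intro add_mono mult_right_mono) auto
  qed
  also have "\<dots> \<le> - (\<kappa> * P) + (2 * lamH) * (m * pE * pH / pE ^ 4) + 1 * (\<theta> * K)"
    using W1 lamH_pos \<theta> K by (intro add_mono mult_left_mono) auto
  finally have "\<kappa> * P \<le> (lamH + K) * \<theta> + 2 * lamH * m * pE * pH / pE ^ 4"
    by (simp add: algebra_simps)
  then have "P \<le> ((lamH + K) * \<theta> + 2 * lamH * m * pE * pH / pE ^ 4) / \<kappa>"
    using \<kappa> by (simp only: pos_le_divide_eq mult.commute)
  moreover have "expect (\<lambda>s. \<phi> (fst s)) \<le> P"
    unfolding P_def by (rule integral_mono[OF i\<phi> iP]) (rule \<phi>\<psi>)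
  ultimately show ?thesis
    by (simp add: \<phi>_def K_def)
qed

section \<open>From the truncated increments to the scaled mean of \<open>h\<close>\<close>

text \<open>Integrate the pointwise bound of \<open>\<theta> * h\<close> by \<open>M\<close> plus
  the positive part of \<open>\<theta> * h - M\<close>. Working in \<open>ennreal\<close> makes
  finiteness of the mean a conclusion.\<close>

lemma scaled_mean_H_le:
  fixes \<theta> M B :: real
  assumes "0 \<le> \<theta>" "0 \<le> M" "0 \<le> B"
    and "(\<integral>\<^sup>+ s. ennreal (max 0 (\<theta> * real (fst s) - M)) \<partial>measure_pmf \<pi>) \<le> ennreal B"
  shows "ennreal \<theta> * (\<integral>\<^sup>+ s. ennreal (real (fst s)) \<partial>measure_pmf \<pi>) \<le> ennreal (M + B)"
proof -
  have "ennreal \<theta> * (\<integral>\<^sup>+ s. ennreal (real (fst s)) \<partial>measure_pmf \<pi>) =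
      (\<integral>\<^sup>+ s. ennreal (\<theta> * real (fst s)) \<partial>measure_pmf \<pi>)"
    using assms by (simp add: ennreal_mult nn_integral_cmult)
  also have "\<dots> \<le> (\<integral>\<^sup>+ s. ennreal M + ennreal (max 0 (\<theta> * real (fst s) - M)) \<partial>measure_pmf \<pi>)"
  proof (rule nn_integral_mono)
    show "ennreal (\<theta> * real (fst s)) \<le> ennreal M + ennreal (max 0 (\<theta> * real (fst s) - M))" for s
      using ennreal_add_le[of M "\<theta> * real (fst s) - M"] by simp
  qed
  also have "\<dots> = ennreal M + (\<integral>\<^sup>+ s. ennreal (max 0 (\<theta> * real (fst s) - M)) \<partial>measure_pmf \<pi>)"
    by (subst nn_integral_add) (simp_all add: measure_pmf.emeasure_space_1)
  also have "\<dots> \<le> ennreal M + ennreal B" using assms by (intro add_left_mono)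
  also have "\<dots> = ennreal (M + B)" using assms by simp
  finally show ?thesis .
qed

text \<open>Integrate the bound of \<open>m\<close> by \<open>\<theta> * h\<close> plus the positive
  part of \<open>m - \<theta> * h\<close>; only the latter, bounded by \<open>m\<close>, is treated
  as a real expectation.\<close>

lemma scaled_mean_H_ge:
  fixes \<theta> m B :: real
  assumes "0 \<le> \<theta>" "0 \<le> m" and "expect (\<lambda>s. max 0 (m - \<theta> * real (fst s))) \<le> B"
  shows "ennreal (m - B) \<le> ennreal \<theta> * (\<integral>\<^sup>+ s. ennreal (real (fst s)) \<partial>measure_pmf \<pi>)"
proof -
  have int: "integrable (measure_pmf \<pi>) (\<lambda>s. max 0 (m - \<theta> * real (fst s)))"
    using assms by (intro integrable_measure_pmf_bounded[where B = m]) auto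
  have B: "0 \<le> B" using assms(3) by (rule order_trans[rotated]) simp
  have "ennreal m = (\<integral>\<^sup>+ s. ennreal m \<partial>measure_pmf \<pi>)"
    by (simp add: measure_pmf.emeasure_space_1)
  also have "\<dots> \<le> (\<integral>\<^sup>+ s. ennreal (\<theta> * real (fst s)) + ennreal (max 0 (m - \<theta> * real (fst s))) \<partial>measure_pmf \<pi>)"
  proof (rule nn_integral_mono)
    show "ennreal m \<le> ennreal (\<theta> * real (fst s)) + ennreal (max 0 (m - \<theta> * real (fst s)))" for s
      using ennreal_add_le[of "\<theta> * real (fst s)" "m - \<theta> * real (fst s)"] by simp
  qed
  also have "\<dots> = ennreal \<theta> * (\<integral>\<^sup>+ s. ennreal (real (fst s)) \<partial>measure_pmf \<pi>) +
      (\<integral>\<^sup>+ s. ennreal (max 0 (m - \<theta> * real (fst s))) \<partial>measure_pmf \<pi>)"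
    using assms by (subst nn_integral_add) (simp_all add: ennreal_mult nn_integral_cmult)
  also have "(\<integral>\<^sup>+ s. ennreal (max 0 (m - \<theta> * real (fst s))) \<partial>measure_pmf \<pi>) =
      ennreal (expect (\<lambda>s. max 0 (m - \<theta> * real (fst s))))"
    by (rule nn_integral_eq_integral[OF int]) simp
  also have "\<dots> \<le> ennreal B" using assms by (intro ennreal_leI)
  finally have "ennreal m \<le> ennreal B + ennreal \<theta> * (\<integral>\<^sup>+ s. ennreal (real (fst s)) \<partial>measure_pmf \<pi>)"
    by (simp add: add_left_mono add.commute)
  then have "ennreal m - ennreal B \<le> ennreal \<theta> * (\<integral>\<^sup>+ s. ennreal (real (fst s)) \<partial>measure_pmf \<pi>)"
    by (simp add: ennreal_minus_le_iff)
  then show ?thesis using B by (simp add: ennreal_minus)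
qed

end

subsection \<open>The limit \<open>pH \<rightarrow> 0\<close>\<close>

text \<open>Any \<open>a < ennreal x\<close> is a finite nonnegative real, so the midpoint between
  it and \<open>x\<close> is a positive level strictly above \<open>a\<close>; from above, density
  provides a finite level between \<open>ennreal x\<close> and \<open>a\<close>.\<close>

lemma tendsto_ennreal_of_eventually_bounds:
  fixes f :: "'a \<Rightarrow> ennreal"
  assumes "0 < x"
    and upper: "\<And>M. x < M \<Longrightarrow> \<forall>\<^sub>F p in F. f p \<le> ennreal M"
    and lower: "\<And>m. 0 < m \<Longrightarrow> m < x \<Longrightarrow> \<forall>\<^sub>F p in F. ennreal m \<le> f p"
  shows "(f \<longlongrightarrow> ennreal x) F"
proof (rule order_tendstoI)
  fix a assume a: "a < ennreal x"
  then obtain r where r: "a = ennreal r" "0 \<le> r"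
    by (cases a) auto
  with a have "r < x" by (simp add: ennreal_less_iff)
  then have "\<forall>\<^sub>F p in F. ennreal ((r + x) / 2) \<le> f p"
    using lower[of "(r + x) / 2"] r \<open>0 < x\<close> by simp
  moreover have "a < ennreal ((r + x) / 2)"
    using r \<open>r < x\<close> by (simp add: ennreal_less_iff)
  ultimately show "\<forall>\<^sub>F p in F. a < f p"
    by (auto elim: eventually_mono)
next
  fix a assume "ennreal x < a"
  then obtain b where b: "ennreal x < b" "b < a" using dense by blast
  then obtain M where M: "b = ennreal M" "0 \<le> M"
    by (cases b) auto
  then have "x < M" using b \<open>0 < x\<close> by (simp add: ennreal_less_iff)
  from upper[OF this] show "\<forall>\<^sub>F p in F. f p < a"
    using b M by (auto elim!: eventually_mono)
qed

lemma one_minus_power_le_exp: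
  fixes x :: real
  assumes "x \<le> 1"
  shows "(1 - x) ^ n \<le> exp (- (x * real n))"
proof -
  have "(1 - x) ^ n \<le> exp (- x) ^ n"
    using assms exp_ge_add_one_self[of "- x"] by (intro power_mono) auto
  then show ?thesis by (simp add: exp_of_nat_mult[symmetric] mult.commute)
qed

text \<open>Applying \<open>1 + t \<le> exp t\<close> at \<open>t = x / (1 - x)\<close> gives
  \<open>exp (- (x / (1 - x))) \<le> 1 - x\<close>. The assumption on \<open>n - 1\<close> matches
  the support of the shifted weight and costs an extra \<open>x\<close> in the exponent.\<close>

lemma one_minus_power_ge_exp:
  fixes x :: real
  assumes x: "0 \<le> x" "x < 1" and n: "x * real (n - 1) < m"
  shows "exp (- ((m + x) / (1 - x))) \<le> (1 - x) ^ n"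
proof -
  have "exp (- (x / (1 - x))) \<le> 1 - x"
  proof -
    have "1 + x / (1 - x) \<le> exp (x / (1 - x))" by (rule exp_ge_add_one_self)
    moreover have "1 + x / (1 - x) = 1 / (1 - x)" using x by (simp add: field_simps)
    ultimately have "1 \<le> exp (x / (1 - x)) * (1 - x)"
      using x by (simp add: pos_divide_le_eq)
    then show ?thesis by (simp add: exp_minus field_simps)
  qed
  then have "exp (- (x / (1 - x))) ^ n \<le> (1 - x) ^ n"
    by (rule power_mono) simp
  moreover have "x * real n \<le> m + x"
    using n x by (cases n) (auto simp: algebra_simps)
  then have "real n * (x / (1 - x)) \<le> (m + x) / (1 - x)"
    using x by (simp add: divide_right_mono mult.commute)
  then have "exp (- ((m + x) / (1 - x))) \<le> exp (- (x / (1 - x))) ^ n"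
    by (simp add: exp_of_nat_mult[symmetric])
  ultimately show ?thesis by linarith
qed

section \<open>Eventual bounds for the family of chains indexed by \<open>pH\<close>\<close>

locale bilateral_match_E_family =
  fixes lamH lamE pE :: real and \<pi> :: "real \<Rightarrow> (nat \<times> nat) pmf"
  assumes lamH_pos: "0 < lamH" and lamE_pos: "0 < lamE" and pE_pos: "0 < pE" and pE_le_1: "pE \<le> 1"
    and stationary: "\<And>pH. 0 < pH \<Longrightarrow> pH < 1 \<Longrightarrow>
      stationary_distribution (bilateral_match_E_rate lamH lamE pE pH) (\<pi> pH)"
begin

lemma chain: "0 < p \<Longrightarrow> p < 1 \<Longrightarrow> bilateral_match_E_stationary lamH lamE pE p (\<pi> p)"
  using lamH_pos lamE_pos pE_pos pE_le_1 stationary by unfold_locales auto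

definition meanH :: "real \<Rightarrow> ennreal" where
  "meanH p = (\<integral>\<^sup>+ s. ennreal (real (fst s)) \<partial>measure_pmf (\<pi> p))"

lemma eventually_unit: "\<forall>\<^sub>F p in at_right (0::real). 0 < p \<and> p < 1"
  using eventually_at_right_real[of 0 "1 :: real"] by (auto elim: eventually_mono)

text \<open>The bounds \<open>v\<close> and \<open>y\<close> past level \<open>M\<close> do not
  depend on \<open>p\<close>, hence neither does the constant \<open>c\<close>, and the error
  \<open>c * \<theta> p\<close> eventually fits into the gap between \<open>M\<close> and
  \<open>M'\<close>. The condition \<open>y < 1\<close> makes \<open>\<eta>\<close>, and with it the
  first entry of \<open>\<kappa>\<close>, positive.\<close>

lemma eventually_scaled_meanH_le:
  fixes \<theta> :: "real \<Rightarrow> real" and M M' v y :: real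
  defines "\<eta> \<equiv> (1 - y) / (1 + y)"
  assumes \<theta>: "(\<theta> \<longlongrightarrow> 0) (at_right 0)" and \<theta>0: "\<And>p. 0 < p \<Longrightarrow> 0 < \<theta> p"
    and M: "0 \<le> M" "M < M'" and y: "0 \<le> y" "y < 1"
    and drift: "0 < lamH * (1 - 2 * v) + \<eta> * lamE"
    and ev: "\<forall>\<^sub>F p in at_right 0. \<forall>h. M < \<theta> p * real h \<longrightarrow> (1 - p\<^sup>2) ^ h \<le> v \<and> (1 - pE * p) ^ h \<le> y"
  shows "\<forall>\<^sub>F p in at_right 0. ennreal (\<theta> p) * meanH p \<le> ennreal M'"
proof -
  define \<kappa> where "\<kappa> = min (\<eta> * (lamH + lamE)) (lamH * (1 - 2 * v) + \<eta> * lamE)"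
  have "0 < \<eta>" using y by (simp add: \<eta>_def)
  then have \<kappa>: "0 < \<kappa>" using drift lamH_pos lamE_pos by (simp add: \<kappa>_def)
  define c where "c = (lamH + (lamH + lamE) / pE ^ 4) / \<kappa> + 1"
  have c: "0 \<le> c" using lamH_pos lamE_pos pE_pos \<kappa> by (simp add: c_def)
  have "((\<lambda>p. M + c * \<theta> p) \<longlongrightarrow> M + c * 0) (at_right 0)"
    by (intro tendsto_intros \<theta>)
  then have "\<forall>\<^sub>F p in at_right 0. M + c * \<theta> p < M'"
    using M by (intro order_tendstoD(2)) auto
  with ev eventually_unit show ?thesis
  proof eventually_elim
    case (elim p)
    interpret bilateral_match_E_stationary lamH lamE pE p "\<pi> p"
      using elim chain by blast
    have "(\<integral>\<^sup>+ s. ennreal (max 0 (\<theta> p * real (fst s) - M)) \<partial>measure_pmf (\<pi> p)) \<le> ennreal (c * \<theta> p)"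
      unfolding c_def
      by (rule expect_H_minus_le[where v = v and y = y])
        (use elim \<theta>0 M y \<kappa> in \<open>auto simp: missHH_def missHE_def \<kappa>_def \<eta>_def\<close>)
    then have "ennreal (\<theta> p) * meanH p \<le> ennreal (M + c * \<theta> p)"
      unfolding meanH_def using elim \<theta>0[of p] M c by (intro scaled_mean_H_le) auto
    also have "\<dots> \<le> ennreal M'" using elim by (intro ennreal_leI) simp
    finally show ?case .
  qed
qed

text \<open>Here the error \<open>B p\<close> has a part of order \<open>\<theta> p\<close> and a
  part of order \<open>p\<close>; both vanish, so it eventually fits into the gap between
  \<open>m'\<close> and \<open>m\<close>.\<close>

lemma eventually_scaled_meanH_ge:
  fixes \<theta> :: "real \<Rightarrow> real" and m m' v y :: real
  defines "\<eta> \<equiv> (1 - y) / (1 + y)"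
  assumes \<theta>: "(\<theta> \<longlongrightarrow> 0) (at_right 0)" and \<theta>0: "\<And>p. 0 < p \<Longrightarrow> 0 < \<theta> p"
    and m: "0 < m" "m' < m" and y: "0 \<le> y"
    and drift: "0 < 2 * lamH * v - lamH - \<eta> * lamE"
    and ev: "\<forall>\<^sub>F p in at_right 0. \<forall>h. \<theta> p * real (h - 1) < m \<longrightarrow> v \<le> (1 - p\<^sup>2) ^ h \<and> y \<le> (1 - pE * p) ^ h"
  shows "\<forall>\<^sub>F p in at_right 0. ennreal m' \<le> ennreal (\<theta> p) * meanH p"
proof -
  define B where "B p = ((lamH + (lamH + lamE) / pE ^ 4) * \<theta> p + 2 * lamH * m * pE * p / pE ^ 4) /
    (2 * lamH * v - lamH - \<eta> * lamE)" for p
  have "((\<lambda>p. m - B p) \<longlongrightarrow> m - ((lamH + (lamH + lamE) / pE ^ 4) * 0 + 2 * lamH * m * pE * 0 / pE ^ 4) /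
    (2 * lamH * v - lamH - \<eta> * lamE)) (at_right 0)"
    unfolding B_def by (intro tendsto_intros \<theta>) (use drift pE_pos in auto)
  then have "\<forall>\<^sub>F p in at_right 0. m' < m - B p"
    using m by (intro order_tendstoD(1)) auto
  with ev eventually_unit show ?thesis
  proof eventually_elim
    case (elim p)
    interpret bilateral_match_E_stationary lamH lamE pE p "\<pi> p"
      using elim chain by blast
    have "expect (\<lambda>s. max 0 (m - \<theta> p * real (fst s))) \<le> B p"
      unfolding B_def \<eta>_def
      by (rule expect_minus_H_le)
        (use elim \<theta>0 m y drift in \<open>auto simp: missHH_def missHE_def \<eta>_def\<close>)
    then have "ennreal (m - B p) \<le> ennreal (\<theta> p) * meanH p"
      unfolding meanH_def using elim \<theta>0[of p] m by (intro scaled_mean_H_ge) auto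
    moreover have "ennreal m' \<le> ennreal (m - B p)" using elim by (intro ennreal_leI) simp
    ultimately show ?case by (rule order_trans[rotated])
  qed
qed

section \<open>The limits in the two regimes\<close>

lemma scaled_meanH_tendsto_if_less:
  assumes less: "lamH < lamE"
  shows "((\<lambda>p. ennreal p * meanH p) \<longlongrightarrow> ennreal (ln ((lamE + lamH) / (lamE - lamH)) / pE)) (at_right 0)"
    (is "(_ \<longlongrightarrow> ennreal ?x) _")
proof (rule tendsto_ennreal_of_eventually_bounds)
  have "1 < (lamE + lamH) / (lamE - lamH)" using less lamH_pos by (simp add: field_simps)
  then show x0: "0 < ?x" using pE_pos by simp
  have exp_x: "exp (- (pE * ?x)) = (lamE - lamH) / (lamE + lamH)"
    using less lamH_pos lamE_pos pE_pos by (simp add: exp_minus)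
  have id: "((\<lambda>p. p) \<longlongrightarrow> 0) (at_right (0::real))" by (rule tendsto_ident_at)
  {
    fix M' assume M': "?x < M'"
    obtain M where M: "?x < M" "M < M'" using dense[OF M'] by blast
    \<comment> \<open>The limiting value of \<open>(1 - pE * p) ^ h\<close> at
      \<open>h = M / p\<close>. As \<open>M > ?x\<close>, it lies strictly below the zero of the
      limiting drift, which leaves room for the trivial bound \<open>v = 1\<close>.\<close>
    define y where "y = exp (- (pE * M))"
    have "y < exp (- (pE * ?x))"
      unfolding y_def using M(1) pE_pos by (simp only: exp_less_cancel_iff neg_less_iff_less mult_less_cancel_left_pos)
    then have yless: "y * (lamE + lamH) < lamE - lamH"
      unfolding exp_x using lamH_pos lamE_pos by (simp add: pos_less_divide_eq)
    have y0: "0 < y" by (simp add: y_def)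
    have y1: "y < 1" using order.strict_trans[OF x0 M(1)] pE_pos by (simp add: y_def)
    show "\<forall>\<^sub>F p in at_right 0. ennreal p * meanH p \<le> ennreal M'"
    proof (rule eventually_scaled_meanH_le[where v = 1 and y = y and M = M])
      have "lamH * (1 + y) < (1 - y) * lamE" using yless by (simp add: algebra_simps)
      then have "lamH < (1 - y) * lamE / (1 + y)" using y0 by (simp add: pos_less_divide_eq)
      then show "0 < lamH * (1 - 2 * 1) + (1 - y) / (1 + y) * lamE" by simp
      show "\<forall>\<^sub>F p in at_right 0. \<forall>h. M < p * real h \<longrightarrow> (1 - p\<^sup>2) ^ h \<le> 1 \<and> (1 - pE * p) ^ h \<le> y"
        using eventually_unit
      proof eventually_elim
        case (elim p)
        show ?case
        proof (intro allI impI conjI)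
          fix h assume h: "M < p * real h"
          show "(1 - p\<^sup>2) ^ h \<le> 1" using elim by (intro power_le_one) (auto simp: abs_square_le_1 power_le_one)
          have "(1 - pE * p) ^ h \<le> exp (- (pE * p * real h))"
            using elim pE_pos pE_le_1 by (intro one_minus_power_le_exp mult_le_one) auto
          also have "\<dots> \<le> y"
            unfolding y_def using h pE_pos by (simp add: mult.assoc)
          finally show "(1 - pE * p) ^ h \<le> y" .
        qed
      qed
    qed (use id M x0 y0 y1 in auto)
  next
    fix m' assume m': "0 < m'" "m' < ?x"
    obtain m where "m' < m" "m < ?x" using dense[OF m'(2)] by blast
    \<comment> \<open>The bound on \<open>(1 - pE * p) ^ h\<close> tends to
      \<open>exp (- (pE * m))\<close> as \<open>p\<close> tends to \<open>0\<close>; taking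
      \<open>y\<close> from the larger \<open>m2\<close> makes the comparison strict, so it holds
      eventually.\<close>
    moreover obtain m2 where "m < m2" "m2 < ?x" using dense[OF \<open>m < ?x\<close>] by blast
    ultimately have m: "0 < m" "m' < m" "m < m2" "m2 < ?x" using m'(1) by simp_all
    define y where "y = exp (- (pE * m2))"
    have y0: "0 < y" by (simp add: y_def)
    have "exp (- (pE * ?x)) < y"
      unfolding y_def using m(4) pE_pos by (simp only: exp_less_cancel_iff neg_less_iff_less mult_less_cancel_left_pos)
    then have yless: "lamE - lamH < y * (lamE + lamH)"
      unfolding exp_x using lamH_pos lamE_pos by (simp add: pos_divide_less_eq)
    define \<delta> where "\<delta> = lamH - (1 - y) / (1 + y) * lamE"
    have "(1 - y) * lamE < lamH * (1 + y)" using yless by (simp add: algebra_simps)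
    then have "(1 - y) * lamE / (1 + y) < lamH" using y0 by (simp add: pos_divide_less_eq)
    then have \<delta>: "0 < \<delta>" by (simp add: \<delta>_def)
    \<comment> \<open>Replacing \<open>1\<close> by \<open>v\<close> costs
      \<open>2 * lamH * (1 - v) = \<delta> / 2\<close>, half of the drift margin
      \<open>\<delta>\<close>.\<close>
    define v where "v = 1 - \<delta> / (4 * lamH)"
    have v: "v < 1" using \<delta> lamH_pos by (simp add: v_def)
    show "\<forall>\<^sub>F p in at_right 0. ennreal m' \<le> ennreal p * meanH p"
    proof (rule eventually_scaled_meanH_ge[where v = v and y = y and m = m])
      have "2 * lamH * v - lamH - (1 - y) / (1 + y) * lamE = \<delta> / 2"
        using lamH_pos by (simp add: v_def \<delta>_def field_simps)
      then show "0 < 2 * lamH * v - lamH - (1 - y) / (1 + y) * lamE" using \<delta> by simp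
      have "((\<lambda>p. exp (- ((p * m + p\<^sup>2) / (1 - p\<^sup>2)))) \<longlongrightarrow> exp (- ((0 * m + 0\<^sup>2) / (1 - 0\<^sup>2)))) (at_right 0)"
        by (intro tendsto_intros) auto
      then have "\<forall>\<^sub>F p in at_right 0. v < exp (- ((p * m + p\<^sup>2) / (1 - p\<^sup>2)))"
        using v by (intro order_tendstoD(1)) auto
      moreover have "((\<lambda>p. exp (- ((pE * m + pE * p) / (1 - pE * p)))) \<longlongrightarrow>
          exp (- ((pE * m + pE * 0) / (1 - pE * 0)))) (at_right 0)"
        by (intro tendsto_intros) auto
      then have "\<forall>\<^sub>F p in at_right 0. y < exp (- ((pE * m + pE * p) / (1 - pE * p)))"
        using m pE_pos by (intro order_tendstoD(1)) (auto simp: y_def)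
      ultimately show "\<forall>\<^sub>F p in at_right 0. \<forall>h. p * real (h - 1) < m \<longrightarrow> v \<le> (1 - p\<^sup>2) ^ h \<and> y \<le> (1 - pE * p) ^ h"
        using eventually_unit
      proof eventually_elim
        case (elim p)
        show ?case
        proof (intro allI impI conjI)
          fix h assume h: "p * real (h - 1) < m"
          \<comment> \<open>On the scale \<open>h\<close> of order \<open>1 / p\<close> the H-H
            matches are negligible: the exponent for \<open>(1 - p\<^sup>2) ^ h\<close> tends to
            \<open>0\<close>.\<close>
          have "p\<^sup>2 * real (h - 1) < p * m"
            using mult_strict_left_mono[OF h, of p] elim by (simp add: power2_eq_square mult.assoc)
          then have "exp (- ((p * m + p\<^sup>2) / (1 - p\<^sup>2))) \<le> (1 - p\<^sup>2) ^ h"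
            using elim by (intro one_minus_power_ge_exp) (auto simp: power_less_one_iff)
          then show "v \<le> (1 - p\<^sup>2) ^ h" using elim by linarith
          have "pE * p < 1"
            by (rule le_less_trans[OF mult_left_le_one_le]) (use elim pE_pos pE_le_1 in auto)
          moreover have "pE * p * real (h - 1) < pE * m"
            using h pE_pos by (simp add: mult.assoc)
          ultimately have "exp (- ((pE * m + pE * p) / (1 - pE * p))) \<le> (1 - pE * p) ^ h"
            using elim pE_pos by (intro one_minus_power_ge_exp) auto
          then show "y \<le> (1 - pE * p) ^ h" using elim by linarith
        qed
      qed
    qed (use id m y0 in auto)
  }
qed

lemma scaled_meanH_tendsto_if_greater:
  assumes greater: "lamE < lamH"
  shows "((\<lambda>p. ennreal (p\<^sup>2) * meanH p) \<longlongrightarrow> ennreal (ln (2 * lamH / (lamH + lamE)))) (at_right 0)"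
    (is "(_ \<longlongrightarrow> ennreal ?x) _")
proof (rule tendsto_ennreal_of_eventually_bounds)
  have "1 < 2 * lamH / (lamH + lamE)" using greater lamE_pos by (simp add: field_simps)
  then show x0: "0 < ?x" by simp
  have exp_x: "exp (- ?x) = (lamH + lamE) / (2 * lamH)"
    using greater lamH_pos lamE_pos by (simp add: exp_minus)
  have "((\<lambda>p::real. p\<^sup>2) \<longlongrightarrow> 0\<^sup>2) (at_right 0)" by (intro tendsto_intros)
  then have sq: "((\<lambda>p::real. p\<^sup>2) \<longlongrightarrow> 0) (at_right 0)" by simp
  {
    fix M' assume M': "?x < M'"
    obtain M where M: "?x < M" "M < M'" using dense[OF M'] by blast
    have M0: "0 < M" using x0 M(1) by linarith
    define v where "v = exp (- M)"
    define \<delta> where "\<delta> = lamH + lamE - 2 * lamH * v"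
    have "v < exp (- ?x)" unfolding v_def using M(1) by (simp only: exp_less_cancel_iff neg_less_iff_less)
    then have \<delta>: "0 < \<delta>"
      unfolding exp_x \<delta>_def using lamH_pos by (simp add: pos_less_divide_eq mult_ac)
    \<comment> \<open>Since \<open>\<eta> \<ge> 1 - 2 * y\<close>, replacing \<open>\<eta>\<close>
      by its limit \<open>1\<close> costs at most \<open>2 * y * lamE \<le> \<delta> / 2\<close>;
      the entry \<open>1 / 2\<close> keeps \<open>y < 1\<close>.\<close>
    define y where "y = min (1 / 2) (\<delta> / (4 * lamE))"
    have y: "0 < y" "y < 1" "2 * y * lamE \<le> \<delta> / 2"
      using \<delta> lamE_pos by (auto simp: y_def min_def field_simps)
    show "\<forall>\<^sub>F p in at_right 0. ennreal (p\<^sup>2) * meanH p \<le> ennreal M'"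
    proof (rule eventually_scaled_meanH_le[where v = v and y = y and M = M])
      have "(1 - 2 * y) * (1 + y) \<le> 1 - y" using y by (simp add: algebra_simps)
      then have "1 - 2 * y \<le> (1 - y) / (1 + y)" using y by (simp add: pos_le_divide_eq)
      then have "(1 - 2 * y) * lamE \<le> (1 - y) / (1 + y) * lamE"
        using lamE_pos by (intro mult_right_mono) auto
      then show "0 < lamH * (1 - 2 * v) + (1 - y) / (1 + y) * lamE"
        using y(3) \<delta> unfolding \<delta>_def by (simp add: algebra_simps)
      have "((\<lambda>p. p / (pE * M)) \<longlongrightarrow> 0 / (pE * M)) (at_right 0)"
        using pE_pos M0 by (intro tendsto_intros) auto
      then have "\<forall>\<^sub>F p in at_right 0. p / (pE * M) < y"
        using y by (intro order_tendstoD(2)) auto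
      then show "\<forall>\<^sub>F p in at_right 0. \<forall>h. M < p\<^sup>2 * real h \<longrightarrow> (1 - p\<^sup>2) ^ h \<le> v \<and> (1 - pE * p) ^ h \<le> y"
        using eventually_unit
      proof eventually_elim
        case (elim p)
        show ?case
        proof (intro allI impI conjI)
          fix h assume h: "M < p\<^sup>2 * real h"
          have "(1 - p\<^sup>2) ^ h \<le> exp (- (p\<^sup>2 * real h))"
            using elim by (intro one_minus_power_le_exp) (auto simp: power_le_one)
          also have "\<dots> \<le> v" unfolding v_def using h by simp
          finally show "(1 - p\<^sup>2) ^ h \<le> v" .
          have "M / p < p * real h"
            using h elim by (simp add: pos_divide_less_eq power2_eq_square mult_ac)
          then have t: "pE * M / p < pE * p * real h"
            using pE_pos mult_strict_left_mono[of "M / p" "p * real h" pE] by (simp add: mult.assoc)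
          have t0: "0 < pE * M / p" using pE_pos M0 elim by simp
          have "(1 - pE * p) ^ h \<le> exp (- (pE * p * real h))"
            using elim pE_pos pE_le_1 by (intro one_minus_power_le_exp mult_le_one) auto
          also have "\<dots> \<le> exp (- (pE * M / p))" using t by simp
          also have "\<dots> = 1 / exp (pE * M / p)" by (simp add: exp_minus divide_inverse)
          \<comment> \<open>For \<open>h > M / p\<^sup>2\<close> the exponent exceeds
            \<open>pE * M / p\<close>, which diverges; the crude bound \<open>t \<le> exp t\<close>
            already gives decay of order \<open>p\<close>.\<close>
          also have "pE * M / p \<le> exp (pE * M / p)"
            using exp_ge_add_one_self[of "pE * M / p"] by linarith
          then have "1 / exp (pE * M / p) \<le> 1 / (pE * M / p)"
            using t0 by (intro divide_left_mono mult_pos_pos) auto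
          also have "\<dots> = p / (pE * M)" by simp
          also have "\<dots> \<le> y" using elim by simp
          finally show "(1 - pE * p) ^ h \<le> y" .
        qed
      qed
    qed (use sq M M0 y in auto)
  next
    fix m' assume m': "0 < m'" "m' < ?x"
    obtain m where "m' < m" "m < ?x" using dense[OF m'(2)] by blast
    moreover obtain m2 where "m < m2" "m2 < ?x" using dense[OF \<open>m < ?x\<close>] by blast
    ultimately have m: "0 < m" "m' < m" "m < m2" "m2 < ?x" using m'(1) by simp_all
    define v where "v = exp (- m2)"
    have "exp (- ?x) < v" unfolding v_def using m(4) by (simp only: exp_less_cancel_iff neg_less_iff_less)
    then have v: "lamH + lamE < 2 * lamH * v"
      unfolding exp_x using lamH_pos by (simp add: pos_divide_less_eq mult_ac)
    show "\<forall>\<^sub>F p in at_right 0. ennreal m' \<le> ennreal (p\<^sup>2) * meanH p"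
    \<comment> \<open>With \<open>y = 0\<close> the E-contribution takes its largest value,
      \<open>\<eta> = 1\<close>, and the drift condition still holds because
      \<open>m2 < ?x\<close>.\<close>
    proof (rule eventually_scaled_meanH_ge[where v = v and y = 0 and m = m])
      show "0 < 2 * lamH * v - lamH - (1 - 0) / (1 + 0) * lamE" using v by simp
      have "((\<lambda>p. exp (- ((m + p\<^sup>2) / (1 - p\<^sup>2)))) \<longlongrightarrow> exp (- ((m + 0\<^sup>2) / (1 - 0\<^sup>2)))) (at_right 0)"
        by (intro tendsto_intros) auto
      then have "\<forall>\<^sub>F p in at_right 0. v < exp (- ((m + p\<^sup>2) / (1 - p\<^sup>2)))"
        using m by (intro order_tendstoD(1)) (auto simp: v_def)
      then show "\<forall>\<^sub>F p in at_right 0. \<forall>h. p\<^sup>2 * real (h - 1) < m \<longrightarrow> v \<le> (1 - p\<^sup>2) ^ h \<and> 0 \<le> (1 - pE * p) ^ h"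
        using eventually_unit
      proof eventually_elim
        case (elim p)
        show ?case
        proof (intro allI impI conjI)
          fix h assume h: "p\<^sup>2 * real (h - 1) < m"
          then have "exp (- ((m + p\<^sup>2) / (1 - p\<^sup>2))) \<le> (1 - p\<^sup>2) ^ h"
            using elim by (intro one_minus_power_ge_exp) (auto simp: power_less_one_iff)
          then show "v \<le> (1 - p\<^sup>2) ^ h" using elim by linarith
          show "0 \<le> (1 - pE * p) ^ h"
            using elim pE_pos pE_le_1 by (intro zero_le_power) (simp add: mult_le_one)
        qed
      qed
    qed (use sq m in auto)
  }
qed

lemma scaled_waiting_time_tendsto:
  assumes "((\<lambda>p. ennreal (\<theta> p) * meanH p) \<longlongrightarrow> ennreal x) F" and "0 \<le> x"
  shows "((\<lambda>p. ennreal (\<theta> p) * avg_waiting_time_H lamH (\<pi> p)) \<longlongrightarrow> ennreal (x / lamH)) F"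
proof -
  have "((\<lambda>p. ennreal (1 / lamH) * (ennreal (\<theta> p) * meanH p)) \<longlongrightarrow> ennreal (1 / lamH) * ennreal x) F"
    by (rule ennreal_tendsto_cmult[OF _ assms(1)]) simp
  moreover have "ennreal (1 / lamH) * (ennreal (\<theta> p) * meanH p) =
      ennreal (\<theta> p) * avg_waiting_time_H lamH (\<pi> p)" for p
    using lamH_pos
    by (simp add: avg_waiting_time_H_def meanH_def divide_ennreal_def inverse_ennreal case_prod_unfold
        inverse_eq_divide mult_ac)
  moreover have "ennreal (1 / lamH) * ennreal x = ennreal (x / lamH)"
    using lamH_pos assms(2) by (simp add: ennreal_mult[symmetric])
  ultimately show ?thesis by simp
qed

end

theorem theorem2:
  fixes lamH lamE pE :: real
    and \<pi> :: "real \<Rightarrow> (nat \<times> nat) pmf"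
  assumes "lamH > 0" and "lamE > 0" and "0 < pE" and "pE \<le> 1"
    and stationary: "\<And>pH. 0 < pH \<Longrightarrow> pH < 1 \<Longrightarrow>
           stationary_distribution (bilateral_match_E_rate lamH lamE pE pH) (\<pi> pH)"
  shows "(lamH < lamE \<longrightarrow>
            (\<exists>L::real.
               ((\<lambda>pH. ennreal pH * avg_waiting_time_H lamH (\<pi> pH)) \<longlongrightarrow> ennreal L) (at_right 0) \<and>
               ln (lamE / (lamE - lamH)) / (pE * lamH) \<le> L \<and>
               L \<le> ln (2 * lamE / (lamE - lamH)) / (pE * lamH))) \<and>
         (lamH > lamE \<longrightarrow>
            ((\<lambda>pH. ennreal (pH\<^sup>2) * avg_waiting_time_H lamH (\<pi> pH)) \<longlongrightarrow>
               ennreal (ln (2 * lamH / (lamH + lamE)) / lamH)) (at_right 0))"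
proof (intro conjI impI)
  interpret bilateral_match_E_family lamH lamE pE \<pi>
    using assms by unfold_locales auto
  {
    assume less: "lamH < lamE"
    define L where "L = ln ((lamE + lamH) / (lamE - lamH)) / (pE * lamH)"
    have "0 \<le> ln ((lamE + lamH) / (lamE - lamH)) / pE"
      using less lamH_pos pE_pos by (simp add: field_simps)
    from scaled_waiting_time_tendsto[OF scaled_meanH_tendsto_if_less[OF less] this]
    have "((\<lambda>pH. ennreal pH * avg_waiting_time_H lamH (\<pi> pH)) \<longlongrightarrow> ennreal L) (at_right 0)"
      by (simp add: L_def)
    \<comment> \<open>The explicit limit has numerator \<open>lamE + lamH\<close>, which lies
      between \<open>lamE\<close> and \<open>2 * lamE\<close> because
      \<open>0 < lamH < lamE\<close>.\<close>
    moreover have "ln (lamE / (lamE - lamH)) \<le> ln ((lamE + lamH) / (lamE - lamH))"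
      "ln ((lamE + lamH) / (lamE - lamH)) \<le> ln (2 * lamE / (lamE - lamH))"
      using less lamH_pos lamE_pos by (simp_all add: divide_right_mono)
    then have "ln (lamE / (lamE - lamH)) / (pE * lamH) \<le> L"
      "L \<le> ln (2 * lamE / (lamE - lamH)) / (pE * lamH)"
      unfolding L_def using pE_pos lamH_pos by (auto intro!: divide_right_mono)
    ultimately show "\<exists>L::real.
        ((\<lambda>pH. ennreal pH * avg_waiting_time_H lamH (\<pi> pH)) \<longlongrightarrow> ennreal L) (at_right 0) \<and>
        ln (lamE / (lamE - lamH)) / (pE * lamH) \<le> L \<and>
        L \<le> ln (2 * lamE / (lamE - lamH)) / (pE * lamH)"
      by blast
  next
    assume greater: "lamE < lamH"
    have "0 \<le> ln (2 * lamH / (lamH + lamE))"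
      using greater lamE_pos by (simp add: field_simps)
    from scaled_waiting_time_tendsto[OF scaled_meanH_tendsto_if_greater[OF greater] this]
    show "((\<lambda>pH. ennreal (pH\<^sup>2) * avg_waiting_time_H lamH (\<pi> pH)) \<longlongrightarrow>
        ennreal (ln (2 * lamH / (lamH + lamE)) / lamH)) (at_right 0)" .
  }
qed

end
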